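(* Let $\psi$ be increasing slowly at infinity and let $0<a<2$ be a $\psi$-Liouville number. Let $e_\triangledown\in\mathbb{E}_\triangledown$, $e_\triangleleft\in\mathbb{E}_\triangleleft$ be unit vectors, $\mathbb F_\bullet=\mathbb{E}_\bullet\ominus\mathrm{span}(e_\bullet)$, $\mathbb F=\mathbb F_\triangledown\oplus\mathbb F_\triangleleft$, and let $\tilde\Gamma\subset\mathbb F$ be a lattice in $\mathbb F$. Let $\Gamma\subset\mathbb{E}$ be the lattice whose dual is $\Gamma^\dagger=\mathrm{span}_\mathbb{Z}(ae_\triangledown+e_\triangleleft,\ e_\triangledown+e_\triangleleft)\oplus\tilde\Gamma$, and assume $\Gamma$ satisfies the standing assumption. Let $\Omega_\triangledown\subset\mathbb{E}_\triangledown$ be a bounded set of finite perimeter and positive volume, $\Upsilon_\triangleleft\subset\mathbb F_\triangleleft$ a bounded set of finite perimeter and positive volume, and for $r>0$ let $\Omega_\triangleleft=[-r,r]e_\triangleleft\times\Upsilon_\triangleleft\subset\mathbb{E}_\triangleleft$. Then there is a sequence $t_n\to\infty$ and a Lebesgue conull set $A\subset(0,\infty)$ such that for all $r\in A$ and all functions $f:(0,\infty)\to(0,\infty)$ with $f(t)\to\infty$, $$\limsup_{n\to\infty}\frac{\mathrm{NV}_{t_n}(\Gamma,\Omega_\triangleleft)}{t_n^{2d_\triangledown}\psi(t_n)^{-2}f(t_n)^{-1}}=\infty.$$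
   Context: $\mathbb{E}=\mathbb{R}^d=\mathbb{E}_\triangledown\oplus\mathbb{E}_\triangleleft$ orthogonal decomposition with $d_\triangledown,d_\triangleleft\ge1$, projections $\pi_\triangledown,\pi_\triangleleft$. A lattice $\Gamma$ satisfies the standing assumption if $\pi_\triangleleft(\Gamma)$ is dense in $\mathbb{E}_\triangleleft$ and $\pi_\triangledown|_\Gamma$ is injective; the dual lattice is $\Gamma^\dagger=\{y:y\cdot\gamma\in\mathbb{Z}\ \forall\gamma\in\Gamma\}$. An increasing $\psi:(0,\infty)\to(0,\infty)$ increases slowly at infinity if for each $\varepsilon>0$, $\psi(r)\le C_\varepsilon r^\varepsilon$ for $r\ge1$. For $x\in\mathbb{R}$, $\|x\|$ is the distance to the nearest integer; $a\in\mathbb{R}$ is a $\psi$-Liouville number if there are integers $q_n\to\infty$ with $\psi(\|q_na\|^{-1})\ge q_n$. For a bounded window $\Omega_\triangleleft$, $\Lambda(\Gamma+\mathbf s;\Omega_\triangleleft)=\pi_\triangledown((\Gamma+\mathbf s)\cap\pi_\triangleleft^{-1}(\Omega_\triangleleft))$ and $\mathrm{NV}_t(\Gamma,\Omega_\triangleleft)=\int_{\mathbb{E}/\Gamma}\Big|\#\big(\Lambda(\Gamma+\mathbf s;\Omega_\triangleleft)\cap t\Omega_\triangledown\big)-\frac{\mathrm{vol}(t\Omega_\triangledown)\mathrm{vol}(\Omega_\triangleleft)}{\mathrm{covol}(\Gamma)}\Big|^2d\mathbf s$, with $\mathbb{E}/\Gamma$ a fundamental domain with Lebesgue measure and $\mathrm{covol}(\Gamma)$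 its volume. *)

theory Defs
  imports "HOL-Analysis.Analysis"
begin

section \<open>Orthonormal bases, Lebesgue measure on a linear subspace\<close>

definition orthonormal_basis_of :: "'a::euclidean_space set \<Rightarrow> 'a set \<Rightarrow> bool" where
  "orthonormal_basis_of V B \<longleftrightarrow> finite B \<and> B \<subseteq> V \<and> span B = V \<and>
     (\<forall>b\<in>B. norm b = 1) \<and> pairwise orthogonal B"

definition orth_compl :: "'a::euclidean_space set \<Rightarrow> 'a set" where
  "orth_compl V = {w. \<forall>v\<in>V. orthogonal v w}"

definition onb :: "'a::euclidean_space set \<Rightarrow> 'a set" where
  "onb V = (SOME B. orthonormal_basis_of V B)"

text \<open>Orthogonal projection onto a subspace V.\<close>
definition orth_proj :: "'a::euclidean_space set \<Rightarrow> 'a \<Rightarrow> 'a" where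
  "orth_proj V x = (\<Sum>b\<in>onb V. (x \<bullet> b) *\<^sub>R b)"

text \<open>The (k-dimensional, k = dim V) Lebesgue measure on a linear subspace V, realised as a
  (complete) measure on the ambient space concentrated on V: it is the image of Lebesgue
  measure on the slab V + [0,1]-cube of an orthonormal basis of the orthogonal complement
  under the orthogonal projection onto V.  For V = UNIV this is Lebesgue measure; for
  V = {0} it is the Dirac measure at 0.\<close>
definition sub_lebesgue :: "'a::euclidean_space set \<Rightarrow> 'a measure" where
  "sub_lebesgue V = completion
     (distr (restrict_space lborel {x. \<forall>b\<in>onb (orth_compl V). 0 \<le> x \<bullet> b \<and> x \<bullet> b \<le> 1})
            borel (orth_proj V))"

section \<open>Sets of finite perimeter (De Giorgi) in a subspace\<close>

text \<open>Admissible test vector fields: C^1, compactly supported, with values in V and norm at most 1.\<close>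
definition test_field :: "'a::euclidean_space set \<Rightarrow> ('a \<Rightarrow> 'a) \<Rightarrow> bool" where
  "test_field V \<phi> \<longleftrightarrow> (\<forall>x. \<phi> differentiable (at x)) \<and>
     (\<forall>v. continuous_on UNIV (\<lambda>x. frechet_derivative \<phi> (at x) v)) \<and>
     bounded {x. \<phi> x \<noteq> 0} \<and> (\<forall>x. \<phi> x \<in> V) \<and> (\<forall>x. norm (\<phi> x) \<le> 1)"

text \<open>Divergence along V.\<close>
definition div_in :: "'a::euclidean_space set \<Rightarrow> ('a \<Rightarrow> 'a) \<Rightarrow> 'a \<Rightarrow> real" where
  "div_in V \<phi> x = (\<Sum>b\<in>onb V. frechet_derivative \<phi> (at x) b \<bullet> b)"

definition finite_perimeter_in :: "'a::euclidean_space set \<Rightarrow> 'a set \<Rightarrow> bool" where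
  "finite_perimeter_in V S \<longleftrightarrow> S \<subseteq> V \<and> S \<in> sets (sub_lebesgue V) \<and>
     bdd_above {(LINT x:S|sub_lebesgue V. div_in V \<phi> x) | \<phi>. test_field V \<phi>}"

section \<open>Lattices\<close>

definition lattice_in :: "'a::euclidean_space set \<Rightarrow> 'a set \<Rightarrow> bool" where
  "lattice_in F L \<longleftrightarrow> (\<exists>B. independent B \<and> span B = F \<and>
      L = {(\<Sum>b\<in>B. of_int (c b) *\<^sub>R b) | c. True})"

definition lattice :: "'a::euclidean_space set \<Rightarrow> bool" where
  "lattice L \<longleftrightarrow> lattice_in UNIV L"

definition dual_lattice :: "'a::euclidean_space set \<Rightarrow> 'a set" where
  "dual_lattice L = {y. \<forall>\<gamma>\<in>L. y \<bullet> \<gamma> \<in> \<int>}"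

definition fundamental_domain :: "'a::euclidean_space set \<Rightarrow> 'a set \<Rightarrow> bool" where
  "fundamental_domain L D \<longleftrightarrow> D \<in> sets lebesgue \<and> (\<forall>x. \<exists>!\<gamma>. \<gamma> \<in> L \<and> x - \<gamma> \<in> D)"

definition fund_dom :: "'a::euclidean_space set \<Rightarrow> 'a set" where
  "fund_dom L = (SOME D. fundamental_domain L D)"

definition covol :: "'a::euclidean_space set \<Rightarrow> real" where
  "covol L = measure lebesgue (fund_dom L)"

section \<open>Cut-and-project sets and number variance\<close>

text \<open>E = E_down (+) E_left is modelled as the product type 'a \<times> 'b (an orthogonal
  decomposition of the Euclidean space 'a \<times> 'b); pi_down = fst, pi_left = snd.\<close>

definition standing_assumption :: "('a::euclidean_space \<times> 'b::euclidean_space) set \<Rightarrow> bool" where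
  "standing_assumption \<Gamma> \<longleftrightarrow> closure (snd ` \<Gamma>) = UNIV \<and> inj_on fst \<Gamma>"

definition cps :: "('a::euclidean_space \<times> 'b::euclidean_space) set \<Rightarrow> 'a \<times> 'b \<Rightarrow> 'b set \<Rightarrow> 'a set" where
  "cps \<Gamma> s W = fst ` ({p. p \<in> (\<lambda>\<gamma>. \<gamma> + s) ` \<Gamma> \<and> snd p \<in> W})"

definition NV :: "real \<Rightarrow> ('a::euclidean_space \<times> 'b::euclidean_space) set \<Rightarrow> 'a set \<Rightarrow> 'b set \<Rightarrow> real" where
  "NV t \<Gamma> W_down W_left =
     (LINT s:fund_dom \<Gamma>|lebesgue.
        (real (card (cps \<Gamma> s W_left \<inter> ((*\<^sub>R) t ` W_down)))
          - measure lebesgue ((*\<^sub>R) t ` W_down) * measure lebesgue W_left / covol \<Gamma>)\<^sup>2)"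

section \<open>Diophantine notions\<close>

definition incr_slowly :: "(real \<Rightarrow> real) \<Rightarrow> bool" where
  "incr_slowly \<psi> \<longleftrightarrow> mono_on {0<..} \<psi> \<and> (\<forall>r>0. \<psi> r > 0) \<and>
     (\<forall>\<epsilon>>0. \<exists>C. \<forall>r\<ge>1. \<psi> r \<le> C * r powr \<epsilon>)"

definition dist_int :: "real \<Rightarrow> real" where
  "dist_int x = \<bar>x - of_int (round x)\<bar>"

definition psi_liouville :: "(real \<Rightarrow> real) \<Rightarrow> real \<Rightarrow> bool" where
  "psi_liouville \<psi> a \<longleftrightarrow> (\<exists>q :: nat \<Rightarrow> int. filterlim q at_top sequentially \<and>
     (\<forall>n. \<psi> (inverse (dist_int (of_int (q n) * a))) \<ge> of_int (q n)))"

end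

theory Submission
  imports Defs "HOL-Complex_Analysis.Cauchy_Integral_Formula"
begin

text \<open>For a good approximation \<open>p/q\<close> of \<open>a\<close> the dual lattice contains the vector
  \<open>\<xi> = (\<epsilon> e\<^sub>\<down>, k e\<^sub>\<leftarrow>)\<close> with \<open>\<epsilon> = q a - p\<close> tiny and \<open>k = q - p\<close> of size at most \<open>2 q\<close>. Unfolding the
  integral over a fundamental domain and Cauchy--Schwarz bound the number variance from below
  by the single Fourier coefficient at \<open>\<xi>\<close>, which is the product of
  \<open>t ^ d\<close> times the Fourier transform of the window \<open>\<Omega>\<^sub>\<down>\<close> at \<open>t \<epsilon>\<close> and of a constant times
  \<open>sin (2 \<pi> k r) / k\<close>. Choose \<open>t = c / \<bar>\<epsilon>\<bar>\<close> where \<open>c \<ge> 1\<close> is not a zero of that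
  transform; then \<open>\<psi> t \<ge> \<psi> (1 / \<bar>\<epsilon>\<bar>) \<ge> q\<close> compensates the factor \<open>1 / k\<close>, and for almost every
  \<open>r\<close> the sine does not tend to 0 along the sequence.\<close>

section \<open>Lattices and fundamental domains\<close>

text \<open>The overview's bound helps only if no factor degenerates with \<open>n\<close>. Since
  \<open>t n * \<bar>\<epsilon> n\<bar> = c\<close>, the factor from \<open>\<Omega>_down\<close> is
  one fixed positive number, and \<open>c \<ge> 1\<close> is what lets monotonicity of
  \<open>\<psi>\<close> pass from the inverse of \<open>\<bar>\<epsilon> n\<bar>\<close> to
  \<open>t n\<close>. The sequence \<open>t\<close> and the exceptional set of radii come from the
  approximations and \<open>\<Omega>_down\<close> alone, so they are fixed before \<open>r\<close>
  and \<open>f\<close>. As \<open>f (t n)\<close> tends to infinity, a sine bounded away from 0 for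
  infinitely many \<open>n\<close> is enough. Subtracting the expected count costs nothing, because
  a nontrivial character has mean zero. The obstacle lies in the encoding. \<open>fund_dom\<close>
  and \<open>onb\<close> are arbitrary choices: a fundamental domain may be unbounded, and the slab
  behind \<open>sub_lebesgue\<close> is known only up to sign. Facts are therefore proved for every
  fundamental domain and both signs. Windows are only measurable for a completed measure, so Fubini
  arguments run on Borel cores, and the null remainders are carried along separately.\<close>

lemma representation_sum_basis:
  fixes B :: "'a::euclidean_space set"
  assumes "independent B" "span B = UNIV" "b \<in> B"
  shows "representation B (\<Sum>b\<in>B. f b *\<^sub>R b) b = f b"
proof -
  have fin: "finite B"
    using assms(1) independent_bound by blast
  have "linear (\<lambda>v. representation B v b)"
    using bounded_linear_representation[OF assms(1,2)] bounded_linear.linear by blast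
  then have "representation B (\<Sum>b\<in>B. f b *\<^sub>R b) b = (\<Sum>c\<in>B. f c * representation B c b)"
    by (simp add: linear_sum[of "\<lambda>v. representation B v b"] linear_cmul[of "\<lambda>v. representation B v b"])
  also have "\<dots> = (\<Sum>c\<in>B. if c = b then f c else 0)"
    by (intro sum.cong) (auto simp: representation_basis[OF assms(1)])
  finally show ?thesis using fin assms(3) by simp
qed

text \<open>Coordinates are bounded linear functionals, so in this form closure under sums,
  discreteness and the floor construction of a fundamental domain become statements about
  integers.\<close>

lemma lattice_coordinates:
  fixes L :: "'a::euclidean_space set"
  assumes "lattice L"
  obtains B where "independent B" "span B = UNIV" "finite B"
    "L = {x. \<forall>b\<in>B. representation B x b \<in> \<int>}"
proof -
  obtain B where B: "independent B" "span B = UNIV"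
    "L = {(\<Sum>b\<in>B. of_int (c b) *\<^sub>R b) | c. True}"
    using assms unfolding lattice_def lattice_in_def by blast
  have fin: "finite B" using B(1) independent_bound by blast
  have "L = {x. \<forall>b\<in>B. representation B x b \<in> \<int>}"
  proof (intro equalityI subsetI)
    fix x assume "x \<in> L"
    then obtain c where "x = (\<Sum>b\<in>B. of_int (c b) *\<^sub>R b)" using B(3) by blast
    then show "x \<in> {x. \<forall>b\<in>B. representation B x b \<in> \<int>}"
      using representation_sum_basis[OF B(1,2)] by simp
  next
    fix x assume x: "x \<in> {x. \<forall>b\<in>B. representation B x b \<in> \<int>}"
    have "x = (\<Sum>b\<in>B. representation B x b *\<^sub>R b)"
      by (rule real_vector.sum_representation_eq[symmetric]) (use B fin in auto)
    also have "\<dots> = (\<Sum>b\<in>B. of_int \<lfloor>representation B x b\<rfloor> *\<^sub>R b)"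
      using x by (intro sum.cong) (auto elim!: Ints_cases)
    finally show "x \<in> L" using B(3) by auto
  qed
  with that B fin show ?thesis by blast
qed

lemma lattice_closed:
  fixes L :: "'a::euclidean_space set"
  assumes "lattice L"
  shows "0 \<in> L" "x \<in> L \<Longrightarrow> y \<in> L \<Longrightarrow> x - y \<in> L" "x \<in> L \<Longrightarrow> y \<in> L \<Longrightarrow> x + y \<in> L"
proof -
  obtain B where B: "independent B" "span B = UNIV" "finite B"
    "L = {x. \<forall>b\<in>B. representation B x b \<in> \<int>}"
    using lattice_coordinates[OF assms] by blast
  have lin: "linear (\<lambda>v. representation B v b)" for b
    using bounded_linear_representation[OF B(1,2)] bounded_linear.linear by blast
  show "0 \<in> L" "x \<in> L \<Longrightarrow> y \<in> L \<Longrightarrow> x - y \<in> L" "x \<in> L \<Longrightarrow> y \<in> L \<Longrightarrow> x + y \<in> L"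
    using B(4) by (auto simp: linear_0[OF lin] linear_diff[OF lin] linear_add[OF lin])
qed

text \<open>Each coordinate functional is bounded on \<open>S\<close>, which leaves finitely many
  integer tuples, and the tuple determines the vector.\<close>

lemma finite_lattice_Int_bounded:
  fixes L :: "'a::euclidean_space set"
  assumes "lattice L" "bounded S"
  shows "finite (L \<inter> S)"
proof -
  obtain B where B: "independent B" "span B = UNIV" "finite B"
    "L = {x. \<forall>b\<in>B. representation B x b \<in> \<int>}"
    using lattice_coordinates[OF assms(1)] by blast
  have "\<forall>b. \<exists>K. \<forall>x\<in>S. \<bar>representation B x b\<bar> \<le> K"
  proof
    fix b
    have "bounded ((\<lambda>x. representation B x b) ` S)"
      by (intro bounded_linear_image assms bounded_linear_representation B)
    then show "\<exists>K. \<forall>x\<in>S. \<bar>representation B x b\<bar> \<le> K"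
      by (auto simp: bounded_iff)
  qed
  then obtain K where K: "\<And>b x. x \<in> S \<Longrightarrow> \<bar>representation B x b\<bar> \<le> K b"
    by metis
  define \<Phi> where "\<Phi> x = restrict (representation B x) B" for x
  have "\<Phi> ` (L \<inter> S) \<subseteq> PiE B (\<lambda>b. {z \<in> \<int>. \<bar>z\<bar> \<le> K b})"
    using K B(4) by (auto simp: \<Phi>_def)
  moreover have "finite (PiE B (\<lambda>b. {z \<in> \<int>. \<bar>z\<bar> \<le> K b}))"
    by (intro finite_PiE B finite_abs_int_segment)
  ultimately have "finite (\<Phi> ` (L \<inter> S))" by (rule finite_subset)
  moreover have "inj_on \<Phi> (L \<inter> S)"
  proof (rule inj_onI)
    fix x y assume "\<Phi> x = \<Phi> y"
    then have "\<And>b. b \<in> B \<Longrightarrow> representation B x b = representation B y b"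
      unfolding \<Phi>_def by (metis restrict_apply)
    then have "(\<Sum>b\<in>B. representation B x b *\<^sub>R b) = (\<Sum>b\<in>B. representation B y b *\<^sub>R b)"
      by (intro sum.cong) auto
    then show "x = y"
      using real_vector.sum_representation_eq[of B _ B] B by auto
  qed
  ultimately show ?thesis by (rule finite_imageD)
qed

lemma countable_lattice:
  fixes L :: "'a::euclidean_space set"
  assumes "lattice L"
  shows "countable L"
proof -
  have "L = (\<Union>n. L \<inter> cball 0 (real n))"
  proof (intro equalityI subsetI)
    fix x assume "x \<in> L"
    moreover obtain n where "norm x \<le> real n" using real_arch_simple by blast
    ultimately show "x \<in> (\<Union>n. L \<inter> cball 0 (real n))" by auto
  qed auto
  moreover have "countable (\<Union>n. L \<inter> cball 0 (real n))"
    by (rule countable_UN) (auto intro!: countable_finite finite_lattice_Int_bounded assms)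
  ultimately show ?thesis by simp
qed

text \<open>The half-open parallelepiped of a lattice basis works, with coordinatewise floors giving
  the unique translate. Existence gives the choice in \<open>fund_dom\<close> its meaning;
  boundedness provides the reference against which an arbitrary fundamental domain is
  compared.\<close>

lemma ex_bounded_fundamental_domain:
  fixes L :: "'a::euclidean_space set"
  assumes "lattice L"
  shows "\<exists>P. fundamental_domain L P \<and> bounded P"
proof -
  obtain B where B: "independent B" "span B = UNIV" "finite B"
    "L = {x. \<forall>b\<in>B. representation B x b \<in> \<int>}"
    using lattice_coordinates[OF assms] by blast
  note bl = bounded_linear_representation[OF B(1,2)]
  have lin: "linear (\<lambda>v. representation B v b)" for b
    using bl bounded_linear.linear by blast
  define P where "P = {x. \<forall>b\<in>B. 0 \<le> representation B x b \<and> representation B x b < 1}"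
  have rep: "x = (\<Sum>b\<in>B. representation B x b *\<^sub>R b)" for x
    by (rule real_vector.sum_representation_eq[symmetric]) (use B in auto)
  have "P \<in> sets borel"
  proof -
    have [measurable]: "(\<lambda>x. representation B x b) \<in> borel_measurable borel" for b
      using linear_continuous_on[OF bl] by (rule borel_measurable_continuous_onI)
    have "P = {x \<in> space borel. \<forall>b\<in>B. 0 \<le> representation B x b \<and> representation B x b < 1}"
      by (simp add: P_def)
    also have "\<dots> \<in> sets borel"
      using B(3) by measurable
    finally show ?thesis .
  qed
  then have "P \<in> sets lebesgue" by simp
  moreover have "\<exists>!\<gamma>. \<gamma> \<in> L \<and> x - \<gamma> \<in> P" for x
  proof
    define g where "g = (\<Sum>b\<in>B. of_int \<lfloor>representation B x b\<rfloor> *\<^sub>R b)"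
    have rg: "representation B g b = of_int \<lfloor>representation B x b\<rfloor>" if "b \<in> B" for b
      unfolding g_def using representation_sum_basis[OF B(1,2) that] .
    show "g \<in> L \<and> x - g \<in> P"
      using B(4) rg by (auto simp: P_def linear_diff[OF lin]) linarith
    fix h assume h: "h \<in> L \<and> x - h \<in> P"
    have "representation B h b = representation B g b" if b: "b \<in> B" for b
    proof -
      obtain z where "representation B h b = of_int z"
        using h b B(4) by (auto elim: Ints_cases)
      moreover have "0 \<le> representation B x b - representation B h b"
        "representation B x b - representation B h b < 1"
        using h b by (auto simp: P_def linear_diff[OF lin])
      ultimately show ?thesis unfolding rg[OF b] by (simp, linarith)
    qed
    then show "h = g"
      by (subst rep[of h], subst rep[of g]) (auto intro!: sum.cong)
  qed
  moreover have "bounded P"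
  proof -
    have "norm x \<le> (\<Sum>b\<in>B. norm b)" if "x \<in> P" for x
    proof -
      have "norm x \<le> (\<Sum>b\<in>B. norm (representation B x b *\<^sub>R b))"
        by (subst rep) (rule norm_sum)
      also have "\<dots> \<le> (\<Sum>b\<in>B. norm b)"
        using that by (intro sum_mono) (auto simp: P_def intro!: mult_left_le_one_le)
      finally show ?thesis .
    qed
    then show ?thesis unfolding bounded_iff by blast
  qed
  ultimately show ?thesis unfolding fundamental_domain_def by blast
qed

lemma fund_dom_fundamental_domain:
  "lattice L \<Longrightarrow> fundamental_domain L (fund_dom L)"
  unfolding fund_dom_def using ex_bounded_fundamental_domain by (metis someI_ex)

section \<open>Translation invariance and unfolding over a fundamental domain\<close>

lemma distr_lebesgue_translation:
  "distr lebesgue lebesgue (\<lambda>x. x + v) = (lebesgue :: 'a::euclidean_space measure)"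
  and lebesgue_translation_measurable:
  "(\<lambda>x. x + v) \<in> lebesgue \<rightarrow>\<^sub>M (lebesgue :: 'a measure)"
proof -
  have eq: "(\<lambda>x. v + (\<Sum>j\<in>Basis. (1 * (x \<bullet> j)) *\<^sub>R j)) = (\<lambda>x::'a. x + v)"
    by (auto simp: euclidean_representation)
  show "(\<lambda>x. x + v) \<in> lebesgue \<rightarrow>\<^sub>M (lebesgue :: 'a measure)"
    using lebesgue_affine_measurable[of "\<lambda>_. 1" v] unfolding eq by simp
  show "distr lebesgue lebesgue (\<lambda>x. x + v) = (lebesgue :: 'a measure)"
    using lebesgue_affine_euclidean[of "\<lambda>_. 1" v] unfolding eq by (simp add: density_1)
qed

lemma lebesgue_integral_translation:
  fixes f :: "'a::euclidean_space \<Rightarrow> 'b::{banach, second_countable_topology}"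
  assumes "f \<in> borel_measurable lebesgue"
  shows "(\<integral>x. f (x + v) \<partial>lebesgue) = (\<integral>x. f x \<partial>lebesgue)"
  using integral_distr[OF lebesgue_translation_measurable[of v] assms]
  by (simp add: distr_lebesgue_translation)

lemma lebesgue_vimage_translation:
  assumes "X \<in> sets (lebesgue :: 'a::euclidean_space measure)"
  shows "{x. x + v \<in> X} \<in> sets lebesgue"
  using measurable_sets[OF lebesgue_translation_measurable assms, of v]
  by (simp add: vimage_def)

text \<open>Lets the lattice be enumerated by a bijection from all natural numbers, so that
  unfolding becomes a plain series.\<close>

lemma infinite_lattice:
  fixes L :: "'a::euclidean_space set"
  assumes "lattice L"
  shows "infinite L"
proof -
  obtain b where b: "b \<in> L" "b \<noteq> 0"
  proof -
    obtain B where B: "independent B" "span B = UNIV" "finite B"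
      "L = {x. \<forall>b\<in>B. representation B x b \<in> \<int>}"
      using lattice_coordinates[OF assms] by blast
    have "B \<noteq> {}"
    proof
      assume "B = {}"
      then have "(UNIV :: 'a set) = {0}" using B(2) by simp
      then show False by (metis SOME_Basis UNIV_I nonzero_Basis singletonD)
    qed
    then obtain b where b: "b \<in> B" by blast
    have "b \<in> L" unfolding B(4) using representation_basis[OF B(1) b] by auto
    moreover have "b \<noteq> 0" using B(1) b dependent_zero by blast
    ultimately show ?thesis using that by blast
  qed
  have "real n *\<^sub>R b \<in> L" for n
    by (induction n) (auto simp: scaleR_left_distrib lattice_closed[OF assms] b)
  then have "range (\<lambda>n. real n *\<^sub>R b) \<subseteq> L" by auto
  moreover have "inj (\<lambda>n. real n *\<^sub>R b)" using b by (auto simp: inj_on_def)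
  ultimately show ?thesis using finite_subset range_inj_infinite by blast
qed

text \<open>The count is a sum over the enumerated lattice. Translating its \<open>n\<close>-th term
  by \<open>e n\<close>, which \<open>\<kappa>\<close> does not notice, carries it from
  \<open>D\<close> to the piece \<open>X \<inter> (D + e n)\<close>, and these pieces tile
  \<open>X\<close>. Integrability is a separate conclusion because a Bochner integral defaults to 0
  without it.\<close>

lemma fundamental_domain_unfold:
  fixes L :: "'a::euclidean_space set" and \<kappa> :: "'a \<Rightarrow> complex"
  assumes L: "lattice L" and D: "fundamental_domain L D" and X: "X \<in> lmeasurable"
    and fin: "\<And>s. finite {\<gamma>\<in>L. \<gamma> + s \<in> X}"
    and \<kappa>[measurable]: "\<kappa> \<in> borel_measurable borel" and bd: "\<And>s. norm (\<kappa> s) \<le> 1"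
    and per: "\<And>s \<gamma>. \<gamma> \<in> L \<Longrightarrow> \<kappa> (s + \<gamma>) = \<kappa> s"
  shows "set_integrable lebesgue D (\<lambda>s. of_nat (card {\<gamma>\<in>L. \<gamma> + s \<in> X}) * \<kappa> s)"
    and "(LINT s:D|lebesgue. of_nat (card {\<gamma>\<in>L. \<gamma> + s \<in> X}) * \<kappa> s) = (LINT x:X|lebesgue. \<kappa> x)"
proof -
  define e where "e = from_nat_into L"
  have e: "bij_betw e UNIV L"
    unfolding e_def by (intro bij_betw_from_nat_into countable_lattice infinite_lattice L)
  then have eL: "e n \<in> L" for n by (auto simp: bij_betw_def)
  have Dm: "D \<in> sets lebesgue" and Du: "\<And>x. \<exists>!\<gamma>. \<gamma> \<in> L \<and> x - \<gamma> \<in> D"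
    using D unfolding fundamental_domain_def by auto
  have Xm: "X \<in> sets lebesgue" using X by (rule fmeasurableD)
  have \<kappa>m: "\<kappa> \<in> borel_measurable lebesgue" by (simp add: measurable_completion)
  define A where "A n = X \<inter> {x. x + (- e n) \<in> D}" for n
  have Am: "A n \<in> sets lebesgue" for n
    unfolding A_def by (intro sets.Int Xm lebesgue_vimage_translation Dm)
  have disj: "A i \<inter> A j = {}" if "i \<noteq> j" for i j
  proof -
    have "e i \<noteq> e j" using e that by (auto simp: bij_betw_def inj_on_def)
    then show ?thesis using Du eL[of i] eL[of j] by (auto simp: A_def)
  qed
  have un: "(\<Union>n. A n) = X"
  proof
    show "X \<subseteq> (\<Union>n. A n)"
    proof
      fix x assume x: "x \<in> X"
      obtain \<gamma> where "\<gamma> \<in> L" "x - \<gamma> \<in> D" using Du by blast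
      moreover then obtain n where "\<gamma> = e n" using e by (auto simp: bij_betw_def)
      ultimately show "x \<in> (\<Union>n. A n)" using x by (auto simp: A_def)
    qed
  qed (auto simp: A_def)
  define f where "f n s = (indicat_real D s * indicat_real X (s + e n)) *\<^sub>R \<kappa> s" for n s
  have f_shift: "f n s = indicat_real (A n) (s + e n) *\<^sub>R \<kappa> (s + e n)" for n s
    unfolding f_def A_def using per[OF eL] by (auto simp: indicator_def)
  have Achi: "integrable lebesgue (\<lambda>x. indicat_real (A n) x *\<^sub>R \<kappa> x)" for n
  proof (rule Bochner_Integration.integrable_bound)
    show "integrable lebesgue (indicat_real X)" using X by (simp add: lmeasurable_iff_integrable)
    show "(\<lambda>x. indicat_real (A n) x *\<^sub>R \<kappa> x) \<in> borel_measurable lebesgue"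
      using Am \<kappa>m by measurable
    show "AE x in lebesgue. norm (indicat_real (A n) x *\<^sub>R \<kappa> x) \<le> norm (indicat_real X x)"
      using bd by (auto simp: A_def indicator_def)
  qed
  have fint: "integrable lebesgue (f n)" for n
    using integrable_distr[OF lebesgue_translation_measurable[of "e n"], of "\<lambda>x. indicat_real (A n) x *\<^sub>R \<kappa> x"] Achi[of n]
    unfolding f_shift by (simp add: distr_lebesgue_translation)
  have fI: "(\<integral>s. f n s \<partial>lebesgue) = (LINT x:A n|lebesgue. \<kappa> x)" for n
    unfolding f_shift set_lebesgue_integral_def
    by (rule lebesgue_integral_translation[OF borel_measurable_integrable[OF Achi]])
  have bij: "bij_betw e {n. s + e n \<in> X} {\<gamma>\<in>L. \<gamma> + s \<in> X}" for s
    using e by (force simp: bij_betw_def inj_on_def add.commute)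
  have finN: "finite {n. s + e n \<in> X}" for s
    using bij_betw_finite[OF bij] fin by blast
  have fsum: "(\<Sum>n. f n s) = indicat_real D s *\<^sub>R (of_nat (card {\<gamma>\<in>L. \<gamma> + s \<in> X}) * \<kappa> s)" for s
  proof -
    have "(\<Sum>n. f n s) = (\<Sum>n\<in>{n. s + e n \<in> X}. f n s)"
      by (rule suminf_finite[OF finN]) (simp add: f_def)
    also have "\<dots> = (\<Sum>n\<in>{n. s + e n \<in> X}. indicat_real D s *\<^sub>R \<kappa> s)"
      by (intro sum.cong) (auto simp: f_def)
    also have "\<dots> = of_nat (card {n. s + e n \<in> X}) * (indicat_real D s *\<^sub>R \<kappa> s)" by simp
    finally show ?thesis using bij_betw_same_card[OF bij] by simp
  qed
  have s1: "AE s in lebesgue. summable (\<lambda>n. norm (f n s))"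
  proof (rule AE_I2)
    fix s show "summable (\<lambda>n. norm (f n s))"
      by (rule summable_finite[OF finN[of s]]) (simp add: f_def)
  qed
  \<comment> \<open>The L1 norms are dominated by the volumes of the disjoint pieces
    \<open>A n\<close>, whose sum is the finite volume of \<open>X\<close>.\<close>
  have s2: "summable (\<lambda>n. \<integral>s. norm (f n s) \<partial>lebesgue)"
  proof (rule summable_comparison_test')
    have "(\<lambda>n. measure lebesgue (A n)) sums measure lebesgue (\<Union>n. A n)"
      by (rule measure_UNION)
        (use Am disj X un in \<open>auto simp: disjoint_family_on_def fmeasurable_def less_top\<close>)
    then show "summable (\<lambda>n. measure lebesgue (A n))" by (rule sums_summable)
    fix n :: nat
    have "(\<integral>s. norm (f n s) \<partial>lebesgue) = (\<integral>s. norm (indicat_real (A n) s *\<^sub>R \<kappa> s) \<partial>lebesgue)"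
      unfolding f_shift
      by (rule lebesgue_integral_translation[OF borel_measurable_integrable[OF integrable_norm[OF Achi]]])
    also have "\<dots> \<le> (\<integral>s. indicat_real (A n) s \<partial>lebesgue)"
    proof (rule integral_mono)
      have "A n \<in> lmeasurable"
        using fmeasurableI2[OF X, of "A n"] Am by (auto simp: A_def)
      then show "integrable lebesgue (indicat_real (A n))" by (simp add: lmeasurable_iff_integrable)
      show "integrable lebesgue (\<lambda>s. norm (indicat_real (A n) s *\<^sub>R \<kappa> s))"
        by (rule integrable_norm[OF Achi])
    qed (use bd in \<open>auto simp: indicator_def\<close>)
    finally show "norm (\<integral>s. norm (f n s) \<partial>lebesgue) \<le> measure lebesgue (A n)"
      using Am by simp
  qed
  show "set_integrable lebesgue D (\<lambda>s. of_nat (card {\<gamma>\<in>L. \<gamma> + s \<in> X}) * \<kappa> s)"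
    using integrable_suminf[OF fint s1 s2] unfolding fsum set_integrable_def .
  have "(LINT s:D|lebesgue. of_nat (card {\<gamma>\<in>L. \<gamma> + s \<in> X}) * \<kappa> s) = (\<Sum>n. LINT x:A n|lebesgue. \<kappa> x)"
    using integral_suminf[OF fint s1 s2] unfolding fsum fI set_lebesgue_integral_def by simp
  also have "\<dots> = (LINT x:(\<Union>n. A n)|lebesgue. \<kappa> x)"
  proof (rule lebesgue_integral_countable_add[symmetric])
    show "set_integrable lebesgue (\<Union>n. A n) \<kappa>"
      unfolding un set_integrable_def
    proof (rule Bochner_Integration.integrable_bound)
      show "integrable lebesgue (indicat_real X)" using X by (simp add: lmeasurable_iff_integrable)
      show "(\<lambda>x. indicat_real X x *\<^sub>R \<kappa> x) \<in> borel_measurable lebesgue"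
        using Xm \<kappa>m by measurable
    qed (use bd in \<open>auto simp: indicator_def\<close>)
  qed (use Am disj in auto)
  finally show "(LINT s:D|lebesgue. of_nat (card {\<gamma>\<in>L. \<gamma> + s \<in> X}) * \<kappa> s) = (LINT x:X|lebesgue. \<kappa> x)"
    using un by simp
qed

text \<open>Unfolding with a translate of \<open>D\<close> in the role of \<open>X\<close> needs a
  count that is identically 1. This is the uniqueness clause at the point \<open>s + v\<close>, with
  the sign of the lattice vector reversed.\<close>

lemma fundamental_domain_translate:
  assumes L: "lattice L" and "fundamental_domain L D"
  shows "\<exists>\<gamma>0. {\<gamma>\<in>L. \<gamma> + s \<in> {x. x + v \<in> D}} = {\<gamma>0}"
proof -
  have neg: "- \<gamma> \<in> L" if "\<gamma> \<in> L" for \<gamma>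
    using lattice_closed(1,2)[OF L] that by (metis diff_0)
  have "\<exists>!\<gamma>. \<gamma> \<in> L \<and> (s + v) - \<gamma> \<in> D"
    using assms(2) unfolding fundamental_domain_def by blast
  then obtain \<gamma> where g: "\<gamma> \<in> L" "(s + v) - \<gamma> \<in> D"
    and uq: "\<And>\<gamma>'. \<gamma>' \<in> L \<Longrightarrow> (s + v) - \<gamma>' \<in> D \<Longrightarrow> \<gamma>' = \<gamma>" by blast
  have "{\<gamma>\<in>L. \<gamma> + s \<in> {x. x + v \<in> D}} = {- \<gamma>}"
  proof (intro equalityI subsetI)
    fix \<delta> assume d: "\<delta> \<in> {\<gamma>\<in>L. \<gamma> + s \<in> {x. x + v \<in> D}}"
    then have "(s + v) - (- \<delta>) \<in> D" by (simp add: algebra_simps)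
    then have "- \<delta> = \<gamma>" using uq neg d by blast
    then show "\<delta> \<in> {- \<gamma>}" by auto
  qed (use g neg in \<open>auto simp: algebra_simps\<close>)
  then show ?thesis by blast
qed

text \<open>An arbitrary \<open>D\<close> might be unbounded. Unfolding the constant 1 against a
  bounded fundamental domain \<open>P\<close>, where every count is 1, shows that 1 is integrable
  over \<open>D\<close>.\<close>

lemma fundamental_domain_lmeasurable:
  assumes L: "lattice L" and D: "fundamental_domain L D"
  shows "D \<in> lmeasurable"
proof -
  obtain P where P: "fundamental_domain L P" "bounded P"
    using ex_bounded_fundamental_domain[OF L] by blast
  have Pl: "P \<in> lmeasurable"
    using P bounded_set_imp_lmeasurable unfolding fundamental_domain_def by blast
  have card: "card {\<gamma>\<in>L. \<gamma> + s \<in> P} = 1" "finite {\<gamma>\<in>L. \<gamma> + s \<in> P}" for s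
    using fundamental_domain_translate[OF L P(1), of s 0] by auto
  have "set_integrable lebesgue D (\<lambda>s. 1 :: complex)"
    using fundamental_domain_unfold(1)[OF L D Pl, of "\<lambda>_. 1"] card by simp
  then have "integrable lebesgue (\<lambda>s. norm (indicat_real D s *\<^sub>R (1::complex)))"
    unfolding set_integrable_def by (rule integrable_norm)
  then have "integrable lebesgue (indicat_real D)" by simp
  then show ?thesis by (simp add: lmeasurable_iff_integrable)
qed

text \<open>Since \<open>D + v\<close> is again a fundamental domain, the integral over
  \<open>D\<close> equals the integral over \<open>D + v\<close>, which is \<open>z\<close> times
  the integral over \<open>D\<close>.\<close>

lemma integral_character_fundamental_domain:
  fixes \<kappa> :: "'a::euclidean_space \<Rightarrow> complex"
  assumes L: "lattice L" and D: "fundamental_domain L D"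
    and \<kappa>[measurable]: "\<kappa> \<in> borel_measurable borel" and bd: "\<And>s. norm (\<kappa> s) \<le> 1"
    and per: "\<And>s \<gamma>. \<gamma> \<in> L \<Longrightarrow> \<kappa> (s + \<gamma>) = \<kappa> s"
    and mult: "\<And>s. \<kappa> (s + v) = \<kappa> s * z" and "z \<noteq> 1"
  shows "(LINT s:D|lebesgue. \<kappa> s) = 0"
proof -
  define X where "X = {x. x + (- v) \<in> D}"
  have Dl: "D \<in> lmeasurable" by (rule fundamental_domain_lmeasurable[OF L D])
  have Dm: "D \<in> sets lebesgue" using Dl by blast
  have \<kappa>m: "\<kappa> \<in> borel_measurable lebesgue" by (simp add: measurable_completion)
  have Xm: "X \<in> sets lebesgue"
    unfolding X_def by (rule lebesgue_vimage_translation[OF Dm])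
  have "X \<in> lmeasurable"
  proof -
    have "X = (+) v ` D" by (force simp: X_def image_iff algebra_simps)
    then show ?thesis using measurable_translation[OF Dl] by simp
  qed
  moreover have card: "card {\<gamma>\<in>L. \<gamma> + s \<in> X} = 1" for s
    using fundamental_domain_translate[OF L D, of s "- v"] by (auto simp: X_def)
  then have "finite {\<gamma>\<in>L. \<gamma> + s \<in> X}" for s
    by (metis card.infinite zero_neq_one)
  ultimately have "(LINT s:D|lebesgue. of_nat (card {\<gamma>\<in>L. \<gamma> + s \<in> X}) * \<kappa> s) = (LINT x:X|lebesgue. \<kappa> x)"
    by (intro fundamental_domain_unfold(2)[OF L D] \<kappa> bd per)
  then have "(LINT s:D|lebesgue. \<kappa> s) = (LINT x:X|lebesgue. \<kappa> x)" by (simp add: card)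
  also have "\<dots> = (\<integral>x. indicat_real X (x + v) *\<^sub>R \<kappa> (x + v) \<partial>lebesgue)"
    unfolding set_lebesgue_integral_def
    by (rule lebesgue_integral_translation[symmetric]) (use Xm \<kappa>m in measurable)
  also have "\<dots> = (LINT s:D|lebesgue. \<kappa> s * z)"
    unfolding set_lebesgue_integral_def mult by (simp add: X_def indicator_def)
  also have "\<dots> = (LINT s:D|lebesgue. \<kappa> s) * z" by simp
  finally show ?thesis using \<open>z \<noteq> 1\<close> by simp
qed

section \<open>Cauchy-Schwarz and the lower bound of the number variance by one character\<close>

lemma (in finite_measure) integral_abs_squared_le:
  fixes g :: "'a \<Rightarrow> real"
  assumes [measurable]: "g \<in> borel_measurable M" and bd: "\<And>x. x \<in> space M \<Longrightarrow> \<bar>g x\<bar> \<le> K"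
  shows "(\<integral>x. \<bar>g x\<bar> \<partial>M)\<^sup>2 \<le> measure M (space M) * (\<integral>x. (g x)\<^sup>2 \<partial>M)"
proof -
  define I where "I = (\<integral>x. \<bar>g x\<bar> \<partial>M)"
  define Q where "Q = (\<integral>x. (g x)\<^sup>2 \<partial>M)"
  define V where "V = measure M (space M)"
  have i1: "integrable M (\<lambda>x. \<bar>g x\<bar>)"
    by (rule integrable_const_bound[of _ K]) (use bd in auto)
  have i2: "integrable M (\<lambda>x. (g x)\<^sup>2)"
  proof (rule integrable_const_bound[of _ "K\<^sup>2"])
    show "AE x in M. norm ((g x)\<^sup>2) \<le> K\<^sup>2"
      using bd by (intro AE_I2) (simp add: abs_le_square_iff[symmetric], meson abs_ge_self order_trans)
  qed simp
  \<comment> \<open>Cauchy-Schwarz comes from the positivity of this quadratic in \<open>x\<close>;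
    for \<open>V > 0\<close> it is evaluated at its minimum \<open>I / V\<close>.\<close>
  have quad: "0 \<le> Q - 2 * x * I + x\<^sup>2 * V" for x
  proof -
    have "0 \<le> (\<integral>y. (\<bar>g y\<bar> - x)\<^sup>2 \<partial>M)" by simp
    also have "\<dots> = (\<integral>y. (g y)\<^sup>2 - 2 * x * \<bar>g y\<bar> + x\<^sup>2 \<partial>M)"
      by (simp add: power2_diff algebra_simps)
    also have "\<dots> = Q - 2 * x * I + x\<^sup>2 * V"
      using i1 i2 by (simp add: Q_def I_def V_def)
    finally show ?thesis .
  qed
  have "I\<^sup>2 \<le> V * Q"
  proof (cases "V = 0")
    case True
    have "I = 0"
    proof (rule ccontr)
      assume "I \<noteq> 0"
      \<comment> \<open>For \<open>V = 0\<close> the expression is affine in \<open>x\<close>, and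
        this choice gives it the value -1.\<close>
      then show False using quad[of "(Q + 1) / (2 * I)"] True by simp
    qed
    then show ?thesis using True by simp
  next
    case False
    then have "V > 0" unfolding V_def using measure_nonneg[of M "space M"] by linarith
    then show ?thesis using quad[of "I / V"] by (simp add: power2_eq_square field_simps)
  qed
  then show ?thesis unfolding I_def Q_def V_def .
qed

text \<open>Subtracting one fixed point of the counted set embeds it into the lattice points of
  \<open>X - X\<close>, a finite set independent of \<open>s\<close>. The uniform bound makes the
  squared discrepancy integrable, so the integral in \<open>NV\<close> is not a default
  value.\<close>

lemma lattice_translate_count_bounded:
  fixes L :: "'a::euclidean_space set"
  assumes L: "lattice L" and X: "bounded X"
  shows "\<exists>K. \<forall>s. finite {\<gamma>\<in>L. \<gamma> + s \<in> X} \<and> card {\<gamma>\<in>L. \<gamma> + s \<in> X} \<le> K"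
proof -
  define E where "E = L \<inter> {x - y | x y. x \<in> X \<and> y \<in> X}"
  have "{x - y | x y. x \<in> X \<and> y \<in> X} = (\<lambda>(x, y). x - y) ` (X \<times> X)"
    by force
  then have finE: "finite E"
    unfolding E_def using bounded_minus[OF X X]
    by (intro finite_lattice_Int_bounded L) simp
  have "finite {\<gamma>\<in>L. \<gamma> + s \<in> X} \<and> card {\<gamma>\<in>L. \<gamma> + s \<in> X} \<le> card E" for s
  proof (cases "{\<gamma>\<in>L. \<gamma> + s \<in> X} = {}")
    case True
    then show ?thesis by (simp only: card.empty) simp
  next
    case False
    then obtain \<gamma>0 where g0: "\<gamma>0 \<in> L" "\<gamma>0 + s \<in> X" by blast
    have inj0: "inj_on (\<lambda>\<gamma>. \<gamma> - \<gamma>0) {\<gamma>\<in>L. \<gamma> + s \<in> X}" by (auto simp: inj_on_def)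
    have sub: "(\<lambda>\<gamma>. \<gamma> - \<gamma>0) ` {\<gamma>\<in>L. \<gamma> + s \<in> X} \<subseteq> E"
    proof (rule image_subsetI)
      fix \<gamma> assume g: "\<gamma> \<in> {\<gamma>\<in>L. \<gamma> + s \<in> X}"
      then have "\<gamma> - \<gamma>0 = (\<gamma> + s) - (\<gamma>0 + s)" by simp
      then show "\<gamma> - \<gamma>0 \<in> E"
        unfolding E_def using g g0 lattice_closed(2)[OF L] by blast
    qed
    show ?thesis
      using inj_on_finite[OF inj0 sub finE] card_inj_on_le[OF inj0 sub finE] by simp
  qed
  then show ?thesis by blast
qed

text \<open>By unfolding, the coefficient of the count at \<open>\<kappa>\<close> is the integral of
  \<open>\<kappa>\<close> over the window. The constant \<open>c\<close> is arbitrary because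
  \<open>\<kappa>\<close> has mean zero over \<open>D\<close>; \<open>v\<close> and \<open>z\<close>
  witness that \<open>\<kappa>\<close> is nontrivial. Injectivity of \<open>fst\<close> identifies
  the projected points with lattice points.\<close>

lemma number_variance_ge_character:
  fixes \<Gamma> :: "('a::euclidean_space \<times> 'b::euclidean_space) set" and \<kappa> :: "'a \<times> 'b \<Rightarrow> complex"
  assumes L: "lattice \<Gamma>" and inj: "inj_on fst \<Gamma>" and D: "fundamental_domain \<Gamma> D"
    and X: "T \<times> W \<in> lmeasurable" and X_bdd: "bounded (T \<times> W)"
    and \<kappa>[measurable]: "\<kappa> \<in> borel_measurable borel" and bd: "\<And>s. norm (\<kappa> s) \<le> 1"
    and per: "\<And>s \<gamma>. \<gamma> \<in> \<Gamma> \<Longrightarrow> \<kappa> (s + \<gamma>) = \<kappa> s"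
    and mult: "\<And>s. \<kappa> (s + v) = \<kappa> s * z" and z: "z \<noteq> 1"
  shows "(norm (LINT x:T \<times> W|lebesgue. \<kappa> x))\<^sup>2
      \<le> measure lebesgue D * (LINT s:D|lebesgue. (real (card (cps \<Gamma> s W \<inter> T)) - c)\<^sup>2)"
proof -
  define N where "N s = real (card {\<gamma>\<in>\<Gamma>. \<gamma> + s \<in> T \<times> W})" for s
  define g where "g s = N s - c" for s
  have card_cps: "real (card (cps \<Gamma> s W \<inter> T)) = N s" for s
  proof -
    have "cps \<Gamma> s W \<inter> T = (\<lambda>\<gamma>. fst (\<gamma> + s)) ` {\<gamma>\<in>\<Gamma>. \<gamma> + s \<in> T \<times> W}"
      unfolding cps_def by (force simp: mem_Times_iff image_iff)
    moreover have "inj_on (\<lambda>\<gamma>. fst (\<gamma> + s)) {\<gamma>\<in>\<Gamma>. \<gamma> + s \<in> T \<times> W}"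
      using inj by (auto simp: inj_on_def)
    ultimately show ?thesis unfolding N_def by (simp add: card_image)
  qed
  have Dl: "D \<in> lmeasurable" by (rule fundamental_domain_lmeasurable[OF L D])
  then have Dm: "D \<in> sets lebesgue" by blast
  define M where "M = lebesgue_on D"
  interpret M: finite_measure M
    unfolding M_def by (rule finite_measure_lebesgue_on[OF Dl])
  have toM: "(LINT s:D|lebesgue. f s) = (\<integral>s. f s \<partial>M)" for f :: "_ \<Rightarrow> 'z::{banach, second_countable_topology}"
    unfolding M_def using Dm by (subst integral_restrict_space) (auto simp: set_lebesgue_integral_def)
  have toMi: "set_integrable lebesgue D f \<longleftrightarrow> integrable M f" for f :: "_ \<Rightarrow> 'z::{banach, second_countable_topology}"
    unfolding M_def set_integrable_def using Dm by (subst integrable_restrict_space) auto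
  have spM: "space M = D" "measure M (space M) = measure lebesgue D"
    using Dm by (auto simp: M_def measure_restrict_space)
  obtain K where fin: "\<And>s. finite {\<gamma>\<in>\<Gamma>. \<gamma> + s \<in> T \<times> W}" and Nle: "\<And>s. N s \<le> real K"
    using lattice_translate_count_bounded[OF L X_bdd] unfolding N_def of_nat_le_iff by blast
  have N_int: "integrable M (\<lambda>s. complex_of_real (N s) * \<kappa> s)"
    using fundamental_domain_unfold(1)[OF L D X fin \<kappa> bd per] by (simp add: toMi N_def)
  \<comment> \<open>Measurability of the counting function is obtained from unfolding with the
    constant character.\<close>
  have "integrable M (\<lambda>s. complex_of_real (N s))"
    using fundamental_domain_unfold(1)[OF L D X fin, of "\<lambda>_. 1"] by (simp add: toMi N_def)
  then have "integrable M N"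
    using integrable_Re by fastforce
  then have Nm: "N \<in> borel_measurable M" by (rule borel_measurable_integrable)
  then have gm: "g \<in> borel_measurable M" unfolding g_def by simp
  have gb: "\<bar>g s\<bar> \<le> real K + \<bar>c\<bar>" for s
    using Nle[of s] by (auto simp: g_def N_def)
  have \<kappa>M: "integrable M \<kappa>"
  proof (rule M.integrable_const_bound[of _ 1])
    show "\<kappa> \<in> borel_measurable M"
      unfolding M_def by (intro measurable_restrict_space1 measurable_completion) simp
  qed (use bd in auto)
  have "(LINT x:T \<times> W|lebesgue. \<kappa> x) = (\<integral>s. complex_of_real (N s) * \<kappa> s \<partial>M)"
    using fundamental_domain_unfold(2)[OF L D X fin \<kappa> bd per] by (simp add: toM N_def)
  also have "\<dots> = (\<integral>s. complex_of_real (N s) * \<kappa> s \<partial>M) - c * (\<integral>s. \<kappa> s \<partial>M)"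
    using integral_character_fundamental_domain[OF L D \<kappa> bd per mult z] by (simp add: toM)
  also have "\<dots> = (\<integral>s. complex_of_real (g s) * \<kappa> s \<partial>M)"
    using N_int \<kappa>M by (simp add: g_def algebra_simps)
  finally have eq: "(LINT x:T \<times> W|lebesgue. \<kappa> x) = (\<integral>s. complex_of_real (g s) * \<kappa> s \<partial>M)" .
  have "norm (LINT x:T \<times> W|lebesgue. \<kappa> x) \<le> (\<integral>s. \<bar>g s\<bar> \<partial>M)"
    unfolding eq
  proof (rule Bochner_Integration.integral_norm_bound_integral)
    show "integrable M (\<lambda>s. complex_of_real (g s) * \<kappa> s)"
      using N_int \<kappa>M by (simp add: g_def algebra_simps)
    show "integrable M (\<lambda>s. \<bar>g s\<bar>)"
      by (rule M.integrable_const_bound[of _ "real K + \<bar>c\<bar>"]) (use gb gm in auto)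
    show "norm (complex_of_real (g s) * \<kappa> s) \<le> \<bar>g s\<bar>" for s
      using bd[of s] by (simp add: norm_mult mult_left_le)
  qed
  then have "(norm (LINT x:T \<times> W|lebesgue. \<kappa> x))\<^sup>2 \<le> (\<integral>s. \<bar>g s\<bar> \<partial>M)\<^sup>2"
    by (intro power_mono) auto
  also have "\<dots> \<le> measure lebesgue D * (\<integral>s. (g s)\<^sup>2 \<partial>M)"
    using M.integral_abs_squared_le[OF gm gb] by (simp only: spM(2))
  finally show ?thesis by (simp add: toM card_cps g_def)
qed

section \<open>Integrals over cylinders, products and dilates\<close>

lemma orthonormal_basis_of_onb:
  fixes V :: "'a::euclidean_space set"
  assumes "subspace V"
  shows "orthonormal_basis_of V (onb V)"
proof -
  obtain B where "B \<subseteq> V" "pairwise orthogonal B" "\<And>x. x \<in> B \<Longrightarrow> norm x = 1"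
    "independent B" "span B = V"
    using orthonormal_basis_subspace[OF assms] by metis
  then have "orthonormal_basis_of V B"
    unfolding orthonormal_basis_of_def using independent_imp_finite by auto
  then show ?thesis unfolding onb_def by (rule someI)
qed

text \<open>The sum over a chosen basis has a value independent of the choice: all basis vectors are
  orthogonal to \<open>e\<close>, so \<open>x\<close> and its component in the hyperplane have the
  same coefficients.\<close>

lemma orth_proj_hyperplane:
  fixes e :: "'a::euclidean_space"
  assumes e: "norm e = 1"
  shows "orth_proj {y. y \<bullet> e = 0} x = x - (x \<bullet> e) *\<^sub>R e"
proof -
  define V where "V = {y. y \<bullet> e = 0}"
  have V: "subspace V" unfolding V_def subspace_def by (auto simp: inner_add_left)
  have B: "finite (onb V)" "onb V \<subseteq> V" "span (onb V) = V" "\<And>b. b \<in> onb V \<Longrightarrow> norm b = 1"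
    "pairwise orthogonal (onb V)"
    using orthonormal_basis_of_onb[OF V] unfolding orthonormal_basis_of_def by auto
  define p where "p = x - (x \<bullet> e) *\<^sub>R e"
  have "p \<in> V" using e by (simp add: V_def p_def inner_diff_left dot_square_norm)
  then have "(\<Sum>b\<in>onb V. (p \<bullet> b) *\<^sub>R b) = p"
    by (intro orthonormal_basis_expand B) (simp_all add: B)
  moreover have "p \<bullet> b = x \<bullet> b" if "b \<in> onb V" for b
    using that B(2) by (auto simp: p_def V_def inner_diff_left inner_commute[of e])
  ultimately show ?thesis
    unfolding orth_proj_def V_def[symmetric] p_def[symmetric] by simp
qed

text \<open>The complement is the line through \<open>e\<close>, so the choice in \<open>onb\<close>
  leaves only a sign open.\<close>

lemma onb_orth_compl_hyperplane:
  fixes e :: "'a::euclidean_space"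
  assumes e: "norm e = 1"
  shows "onb (orth_compl {y. y \<bullet> e = 0}) = {e} \<or> onb (orth_compl {y. y \<bullet> e = 0}) = {- e}"
proof -
  define V where "V = orth_compl {y. y \<bullet> e = 0}"
  have ee: "e \<bullet> e = 1" using e by (simp add: dot_square_norm)
  have V_eq: "V = range (\<lambda>t. t *\<^sub>R e)"
  proof (intro equalityI subsetI)
    fix w assume w: "w \<in> V"
    define p where "p = w - (w \<bullet> e) *\<^sub>R e"
    have pe: "p \<bullet> e = 0" using ee by (simp add: p_def inner_diff_left)
    then have "p \<bullet> w = 0" using w by (simp add: V_def orth_compl_def orthogonal_def)
    then have "p \<bullet> p = 0" using pe by (simp add: p_def inner_diff_right)
    then show "w \<in> range (\<lambda>t. t *\<^sub>R e)" by (simp add: p_def image_iff) blast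
  qed (auto simp: V_def orth_compl_def orthogonal_def)
  have sV: "subspace V"
    unfolding V_def orth_compl_def subspace_def by (auto simp: orthogonal_clauses)
  define B where "B = onb V"
  have B: "B \<subseteq> V" "span B = V" "\<And>b. b \<in> B \<Longrightarrow> norm b = 1" "pairwise orthogonal B"
    using orthonormal_basis_of_onb[OF sV] unfolding orthonormal_basis_of_def B_def by auto
  have pm: "b = e \<or> b = - e" if b: "b \<in> B" for b
  proof -
    obtain t where t: "b = t *\<^sub>R e" using b B(1) V_eq by auto
    then have "\<bar>t\<bar> = 1" using B(3)[OF b] e by simp
    then have "t = 1 \<or> t = - 1" by linarith
    then show ?thesis using t by auto
  qed
  have "B \<noteq> {}"
  proof
    assume "B = {}"
    then have "V = {0}" using B(2) by simp
    moreover have "e \<in> V" unfolding V_eq by (rule range_eqI[of _ _ 1]) simp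
    ultimately show False using e by simp
  qed
  moreover have "\<not> (e \<in> B \<and> - e \<in> B)"
  proof
    assume "e \<in> B \<and> - e \<in> B"
    moreover have "e \<noteq> - e" using ee by (metis e eq_neg_iff_add_eq_0 norm_zero scaleR_2 scaleR_eq_0_iff zero_neq_one zero_neq_numeral)
    ultimately have "orthogonal e (- e)" using B(4) unfolding pairwise_def by blast
    then show False using ee by (simp add: orthogonal_def)
  qed
  ultimately have "B = {e} \<or> B = {- e}" using pm by blast
  then show ?thesis unfolding B_def V_def .
qed

lemma nn_integral_lborel_translation:
  fixes f :: "'a::euclidean_space \<Rightarrow> ennreal"
  assumes [measurable]: "f \<in> borel_measurable borel"
  shows "(\<integral>\<^sup>+x. f (v + x) \<partial>lborel) = (\<integral>\<^sup>+x. f x \<partial>lborel)"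
proof -
  have "(\<integral>\<^sup>+x. f x \<partial>lborel) = (\<integral>\<^sup>+x. f x \<partial>distr lborel borel ((+) v))"
    by (simp add: lborel_distr_plus)
  also have "\<dots> = (\<integral>\<^sup>+x. f (v + x) \<partial>lborel)"
    by (rule nn_integral_distr) auto
  finally show ?thesis by simp
qed

lemma nn_integral_indicator_shift_Icc:
  "(\<integral>\<^sup>+s. indicator {0..1::real} (x + s) \<partial>lborel) = 1"
  using nn_integral_lborel_translation[of "indicator {0..1::real}" x] by simp

text \<open>Integrating over an auxiliary translation in direction \<open>e\<close> and applying Tonelli
  twice separates the coordinate along \<open>e\<close> without choosing an isometry of the space with a
  product.\<close>

lemma nn_integral_cylinder:
  fixes e :: "'a::euclidean_space" and h :: "real \<Rightarrow> ennreal"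
  assumes e: "norm e = 1" and S[measurable]: "S \<in> sets borel"
    and h[measurable]: "h \<in> borel_measurable borel"
  shows "(\<integral>\<^sup>+x. indicator S (x - (x \<bullet> e) *\<^sub>R e) * h (x \<bullet> e) \<partial>lborel) =
    (\<integral>\<^sup>+x. indicator S (x - (x \<bullet> e) *\<^sub>R e) * indicator {0..1} (x \<bullet> e) \<partial>lborel) * (\<integral>\<^sup>+s. h s \<partial>lborel)"
proof -
  define p where "p x = x - (x \<bullet> e) *\<^sub>R e" for x
  have ee: "e \<bullet> e = 1" using e by (simp add: dot_square_norm)
  have [measurable]: "p \<in> borel_measurable borel" unfolding p_def by measurable
  have p_shift: "p (s *\<^sub>R e + x) = p x" for s x
    using ee by (simp add: p_def inner_add_left algebra_simps)
  have e_shift: "(s *\<^sub>R e + x) \<bullet> e = s + x \<bullet> e" for s x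
    using ee by (simp add: inner_add_left)
  have "(\<integral>\<^sup>+x. indicator S (p x) * h (x \<bullet> e) \<partial>lborel)
      = (\<integral>\<^sup>+x. (\<integral>\<^sup>+s. indicator S (p x) * h (x \<bullet> e) * indicator {0..1} (x \<bullet> e + s) \<partial>lborel) \<partial>lborel)"
    by (simp add: nn_integral_cmult nn_integral_indicator_shift_Icc)
  also have "\<dots> = (\<integral>\<^sup>+s. (\<integral>\<^sup>+x. indicator S (p x) * h (x \<bullet> e) * indicator {0..1} (x \<bullet> e + s) \<partial>lborel) \<partial>lborel)"
    by (rule lborel_pair.Fubini') measurable
  \<comment> \<open>Shifting \<open>x\<close> by \<open>- s\<close> along \<open>e\<close> fixes
    \<open>p x\<close> and moves the dependence on \<open>s\<close> from the cutoff into
    \<open>h\<close>. The inner integral over \<open>s\<close> then no longer depends on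
    \<open>x\<close>.\<close>
  also have "\<dots> = (\<integral>\<^sup>+s. (\<integral>\<^sup>+x. indicator S (p x) * h (x \<bullet> e - s) * indicator {0..1} (x \<bullet> e) \<partial>lborel) \<partial>lborel)"
  proof (rule nn_integral_cong)
    fix s :: real
    have "(\<integral>\<^sup>+x. indicator S (p x) * h (x \<bullet> e) * indicator {0..1} (x \<bullet> e + s) \<partial>lborel)
      = (\<integral>\<^sup>+x. indicator S (p ((- s) *\<^sub>R e + x)) * h (((- s) *\<^sub>R e + x) \<bullet> e) * indicator {0..1} (((- s) *\<^sub>R e + x) \<bullet> e + s) \<partial>lborel)"
      by (rule nn_integral_lborel_translation[symmetric]) measurable
    also have "\<dots> = (\<integral>\<^sup>+x. indicator S (p x) * h (x \<bullet> e - s) * indicator {0..1} (x \<bullet> e) \<partial>lborel)"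
      unfolding p_shift e_shift by simp
    finally show "(\<integral>\<^sup>+x. indicator S (p x) * h (x \<bullet> e) * indicator {0..1} (x \<bullet> e + s) \<partial>lborel)
      = (\<integral>\<^sup>+x. indicator S (p x) * h (x \<bullet> e - s) * indicator {0..1} (x \<bullet> e) \<partial>lborel)" .
  qed
  also have "\<dots> = (\<integral>\<^sup>+x. (\<integral>\<^sup>+s. indicator S (p x) * h (x \<bullet> e - s) * indicator {0..1} (x \<bullet> e) \<partial>lborel) \<partial>lborel)"
    by (rule lborel_pair.Fubini') measurable
  also have "\<dots> = (\<integral>\<^sup>+x. indicator S (p x) * indicator {0..1} (x \<bullet> e) * (\<integral>\<^sup>+s. h s \<partial>lborel) \<partial>lborel)"
  proof (rule nn_integral_cong)
    fix x :: 'a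
    have "(\<integral>\<^sup>+s. h s \<partial>lborel) = (\<integral>\<^sup>+s. h (x \<bullet> e - s) \<partial>lborel)"
      using nn_integral_real_affine[of h "-1" "x \<bullet> e"] by simp
    moreover have "(\<integral>\<^sup>+s. indicator S (p x) * h (x \<bullet> e - s) * indicator {0..1} (x \<bullet> e) \<partial>lborel)
      = (\<integral>\<^sup>+s. (indicator S (p x) * indicator {0..1} (x \<bullet> e)) * h (x \<bullet> e - s) \<partial>lborel)"
      by (simp add: ac_simps)
    ultimately show "(\<integral>\<^sup>+s. indicator S (p x) * h (x \<bullet> e - s) * indicator {0..1} (x \<bullet> e) \<partial>lborel)
      = indicator S (p x) * indicator {0..1} (x \<bullet> e) * (\<integral>\<^sup>+s. h s \<partial>lborel)"
      by (simp add: nn_integral_cmult)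
  qed
  also have "\<dots> = (\<integral>\<^sup>+x. indicator S (p x) * indicator {0..1} (x \<bullet> e) \<partial>lborel) * (\<integral>\<^sup>+s. h s \<partial>lborel)"
    by (rule nn_integral_multc) measurable
  finally show ?thesis unfolding p_def .
qed

text \<open>Makes the Borel measure behind \<open>sub_lebesgue\<close> explicit. The open sign turns
  the slab into 0..1 or -1..0 along \<open>e\<close>; by the cylinder formula only its length 1
  matters.\<close>

lemma emeasure_slab_projection:
  fixes e :: "'a::euclidean_space"
  assumes e: "norm e = 1" and S[measurable]: "S \<in> sets borel"
  defines "V \<equiv> {y. y \<bullet> e = 0}"
  shows "emeasure (distr (restrict_space lborel {x. \<forall>b\<in>onb (orth_compl V). 0 \<le> x \<bullet> b \<and> x \<bullet> b \<le> 1})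
            borel (orth_proj V)) S
    = (\<integral>\<^sup>+x. indicator S (x - (x \<bullet> e) *\<^sub>R e) * indicator {0..1} (x \<bullet> e) \<partial>lborel)"
proof -
  define p where "p x = x - (x \<bullet> e) *\<^sub>R e" for x
  have [measurable]: "p \<in> borel_measurable borel" unfolding p_def by measurable
  have pV: "orth_proj V = p"
    unfolding V_def p_def using orth_proj_hyperplane[OF e] by blast
  obtain I where I: "{x. \<forall>b\<in>onb (orth_compl V). 0 \<le> x \<bullet> b \<and> x \<bullet> b \<le> 1} = {x. x \<bullet> e \<in> I}"
    and I_cases: "I = {0..1::real} \<or> I = {-1..0}"
    using onb_orth_compl_hyperplane[OF e]
  proof (elim disjE)
    assume "onb (orth_compl {y. y \<bullet> e = 0}) = {e}"
    then show thesis by (intro that[of "{0..1}"]) (auto simp: V_def)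
  next
    assume "onb (orth_compl {y. y \<bullet> e = 0}) = {- e}"
    then show thesis by (intro that[of "{-1..0}"]) (auto simp: V_def)
  qed
  have [measurable]: "I \<in> sets borel" using I_cases by auto
  have "{x. x \<bullet> e \<in> I} = {x \<in> space borel. x \<bullet> e \<in> I}" by simp
  also have "\<dots> \<in> sets borel" by measurable
  finally have [measurable]: "{x. x \<bullet> e \<in> I} \<in> sets borel" .
  have pm: "p \<in> restrict_space lborel {x. x \<bullet> e \<in> I} \<rightarrow>\<^sub>M borel"
    by (intro measurable_restrict_space1) simp
  have "emeasure (distr (restrict_space lborel {x. x \<bullet> e \<in> I}) borel p) S
      = emeasure (restrict_space lborel {x. x \<bullet> e \<in> I}) (p -` S \<inter> {x. x \<bullet> e \<in> I})"
    using emeasure_distr[OF pm S] by (simp add: space_restrict_space)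
  also have "\<dots> = emeasure lborel (p -` S \<inter> {x. x \<bullet> e \<in> I})"
    by (rule emeasure_restrict_space) auto
  also have "\<dots> = (\<integral>\<^sup>+x. indicator (p -` S \<inter> {x. x \<bullet> e \<in> I}) x \<partial>lborel)"
  proof (rule nn_integral_indicator[symmetric])
    have "p -` S \<inter> space borel \<in> sets borel" by measurable
    then show "p -` S \<inter> {x. x \<bullet> e \<in> I} \<in> sets lborel" by simp
  qed
  also have "\<dots> = (\<integral>\<^sup>+x. indicator S (p x) * indicator I (x \<bullet> e) \<partial>lborel)"
    by (intro nn_integral_cong) (simp add: indicator_def)
  also have "\<dots> = (\<integral>\<^sup>+x. indicator S (p x) * indicator {0..1} (x \<bullet> e) \<partial>lborel) * emeasure lborel I"
    unfolding p_def by (subst nn_integral_cylinder[OF e S]) auto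
  also have "emeasure lborel I = 1" using I_cases by auto
  finally show ?thesis unfolding I pV by (simp add: p_def[symmetric])
qed

text \<open>Fubini along \<open>e\<close>: the map taking \<open>y\<close> to
  \<open>y \<bullet> e\<close> pushes volume on the cylinder over \<open>U\<close> to
  \<open>v\<close> times length, where \<open>v\<close> is the hyperplane measure of
  \<open>U\<close>. Characters that oscillate only along \<open>e\<close> are thereby reduced to
  integrals over an interval.\<close>

lemma cylinder_slices:
  fixes e :: "'a::euclidean_space"
  assumes e: "norm e = 1" and Usub: "U \<subseteq> {y. y \<bullet> e = 0}"
    and Upos: "measure (sub_lebesgue {y. y \<bullet> e = 0}) U > 0"
  obtains v where "v > 0"
    "\<And>r. {s *\<^sub>R e + u | s u. s \<in> {-r..r} \<and> u \<in> U} \<in> sets lebesgue"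
    "\<And>r h. h \<in> borel_measurable borel \<Longrightarrow>
      (LINT y:{s *\<^sub>R e + u | s u. s \<in> {-r..r} \<and> u \<in> U}|lebesgue. h (y \<bullet> e))
        = complex_of_real v * (LINT s:{-r..r}|lborel. h s)"
proof -
  define V where "V = {y. y \<bullet> e = 0}"
  define p where "p x = x - (x \<bullet> e) *\<^sub>R e" for x
  have ee: "e \<bullet> e = 1" using e by (simp add: dot_square_norm)
  have pm[measurable]: "p \<in> borel_measurable borel" unfolding p_def by measurable
  define M where "M = distr (restrict_space lborel {x. \<forall>b\<in>onb (orth_compl V). 0 \<le> x \<bullet> b \<and> x \<bullet> b \<le> 1})
            borel (orth_proj V)"
  have subM: "sub_lebesgue V = completion M" unfolding sub_lebesgue_def M_def ..
  have setsM: "sets M = sets borel" by (simp add: M_def)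
  have emM: "emeasure M S = (\<integral>\<^sup>+x. indicator S (p x) * indicator {0..1} (x \<bullet> e) \<partial>lborel)"
    if "S \<in> sets borel" for S
    unfolding M_def V_def p_def by (rule emeasure_slab_projection[OF e that])
  \<comment> \<open>\<open>measure\<close> is 0 off the sigma-algebra, so a positive value forces
    measurability.\<close>
  have Uset: "U \<in> sets (completion M)"
    using Upos measure_notin_sets unfolding V_def[symmetric] subM by fastforce
  define S where "S = main_part M U"
  have S[measurable]: "S \<in> sets borel"
    using Uset main_part_sets setsM unfolding S_def by blast
  obtain N where N: "N \<in> null_sets M" "null_part M U \<subseteq> N"
    using null_part[OF Uset] by blast
  have Nb[measurable]: "N \<in> sets borel" using N(1) setsM by auto
  have US: "U = S \<union> null_part M U"
    using main_part_null_part_Un[OF Uset] by (simp add: S_def)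
  define v where "v = measure (completion M) U"
  have v: "v > 0" using Upos unfolding v_def V_def[symmetric] subM .
  \<comment> \<open>Likewise \<open>measure\<close> is 0 where \<open>emeasure\<close> is infinite,
    so a positive value forces finiteness.\<close>
  have "emeasure (completion M) U = ennreal v"
  proof -
    have "emeasure (completion M) U \<noteq> \<infinity>"
      using v unfolding v_def measure_def by auto
    then show ?thesis unfolding v_def by (simp add: emeasure_eq_ennreal_measure)
  qed
  then have emS: "emeasure M S = ennreal v"
    using Uset by (simp add: S_def)
  have cyl: "(\<integral>\<^sup>+x. indicator T (p x) * h (x \<bullet> e) \<partial>lborel) = emeasure M T * (\<integral>\<^sup>+s. h s \<partial>lborel)"
    if "T \<in> sets borel" "h \<in> borel_measurable borel" for T h
    unfolding emM[OF that(1)] using nn_integral_cylinder[OF e that] unfolding p_def .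
  \<comment> \<open>The whole unbounded cylinder over \<open>N\<close> is null, since 0 times
    infinity is 0 in \<open>ennreal\<close>; one null set thus serves all \<open>r\<close>.\<close>
  have pN: "{x. p x \<in> N} \<in> null_sets lborel"
  proof -
    have pNm: "{x. p x \<in> N} \<in> sets borel"
      using measurable_sets[OF pm Nb] by (simp add: vimage_def)
    have "emeasure lborel {x. p x \<in> N} = (\<integral>\<^sup>+x. indicator {x. p x \<in> N} x \<partial>lborel)"
      using pNm by simp
    also have "\<dots> = (\<integral>\<^sup>+x. indicator N (p x) * 1 \<partial>lborel)"
      by (intro nn_integral_cong) (simp add: indicator_def)
    also have "\<dots> = 0" using cyl[OF Nb, of "\<lambda>_. 1"] N(1) by (simp add: null_setsD1)
    finally show ?thesis using pNm by auto
  qed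
  define W where "W r = {s *\<^sub>R e + u | s u. s \<in> {-r..r} \<and> u \<in> U}" for r
  have W_eq: "W r = {y. p y \<in> U \<and> y \<bullet> e \<in> {-r..r}}" for r
  proof (intro equalityI subsetI)
    fix y assume "y \<in> W r"
    then obtain s u where su: "y = s *\<^sub>R e + u" "s \<in> {-r..r}" "u \<in> U" unfolding W_def by blast
    moreover have "u \<bullet> e = 0" using Usub su(3) by auto
    ultimately have "y \<bullet> e = s" "p y = u" using ee by (auto simp: p_def inner_add_left)
    then show "y \<in> {y. p y \<in> U \<and> y \<bullet> e \<in> {-r..r}}" using su by auto
  next
    fix y assume y: "y \<in> {y. p y \<in> U \<and> y \<bullet> e \<in> {-r..r}}"
    have "y = (y \<bullet> e) *\<^sub>R e + p y" by (simp add: p_def)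
    then show "y \<in> W r" using y unfolding W_def by blast
  qed
  define W' where "W' r = {y. p y \<in> S \<and> y \<bullet> e \<in> {-r..r}}" for r
  have W'm[measurable]: "W' r \<in> sets borel" for r
  proof -
    have "W' r = {y \<in> space borel. p y \<in> S \<and> y \<bullet> e \<in> {-r..r}}" by (simp add: W'_def)
    also have "\<dots> \<in> sets borel" by measurable
    finally show ?thesis .
  qed
  have Wsub: "W r - W' r \<subseteq> {x. p x \<in> N}" "W' r \<subseteq> W r" for r
    using US N(2) unfolding W_eq W'_def by auto
  have Wm: "W r \<in> sets lebesgue" for r
  proof -
    have "W r - W' r \<in> sets lebesgue"
      using pN Wsub(1) by (rule null_sets_completion)
    then have "W' r \<union> (W r - W' r) \<in> sets lebesgue" by (intro sets.Un) auto
    then show ?thesis using Wsub(2) by (simp add: Un_absorb1)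
  qed
  \<comment> \<open>The cylinder formula with \<open>h\<close> an indicator determines the
    pushforward on every Borel set.\<close>
  have dist: "distr (density lborel (\<lambda>x. indicator S (p x))) borel (\<lambda>x. x \<bullet> e) = density lborel (\<lambda>_. ennreal v)"
  proof (rule measure_eqI)
    fix A assume "A \<in> sets (distr (density lborel (\<lambda>x. indicator S (p x))) borel (\<lambda>x. x \<bullet> e))"
    then have A[measurable]: "A \<in> sets borel" by simp
    have "emeasure (distr (density lborel (\<lambda>x. indicator S (p x))) borel (\<lambda>x. x \<bullet> e)) A
        = emeasure (density lborel (\<lambda>x. indicator S (p x))) ((\<lambda>x. x \<bullet> e) -` A)"
      by (subst emeasure_distr) auto
    also have "\<dots> = (\<integral>\<^sup>+x. indicator S (p x) * indicator ((\<lambda>x. x \<bullet> e) -` A) x \<partial>lborel)"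
    proof (rule emeasure_density)
      have "(\<lambda>x. x \<bullet> e) -` A \<inter> space borel \<in> sets borel" by measurable
      then show "(\<lambda>x. x \<bullet> e) -` A \<in> sets lborel" by simp
    qed simp
    also have "\<dots> = (\<integral>\<^sup>+x. indicator S (p x) * indicator A (x \<bullet> e) \<partial>lborel)"
      by (intro nn_integral_cong) (simp add: indicator_def)
    also have "\<dots> = ennreal v * emeasure lborel A"
      using cyl[OF S, of "indicator A"] emS by simp
    also have "\<dots> = emeasure (density lborel (\<lambda>_. ennreal v)) A"
      by (subst emeasure_density) (auto simp: nn_integral_cmult)
    finally show "emeasure (distr (density lborel (\<lambda>x. indicator S (p x))) borel (\<lambda>x. x \<bullet> e)) A
      = emeasure (density lborel (\<lambda>_. ennreal v)) A" .
  qed simp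
  have "(LINT y:W r|lebesgue. h (y \<bullet> e)) = complex_of_real v * (LINT s:{-r..r}|lborel. h s)"
    if h[measurable]: "h \<in> borel_measurable borel" for r and h :: "real \<Rightarrow> complex"
  proof -
    have hm: "(\<lambda>y. h (y \<bullet> e)) \<in> borel_measurable lebesgue"
      by (intro measurable_completion) simp
    have "(LINT y:W r|lebesgue. h (y \<bullet> e)) = (LINT y:W' r|lebesgue. h (y \<bullet> e))"
    proof (rule set_integral_cong_set)
      show "set_borel_measurable lebesgue (W r) (\<lambda>y. h (y \<bullet> e))"
        unfolding set_borel_measurable_def using Wm[of r] hm by measurable
      show "set_borel_measurable lebesgue (W' r) (\<lambda>y. h (y \<bullet> e))"
        unfolding set_borel_measurable_def using hm
        by (intro borel_measurable_scaleR borel_measurable_indicator) auto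
      have "AE x in lborel. x \<notin> {x. p x \<in> N}" using pN by (rule AE_not_in)
      then have "AE x in lebesgue. x \<notin> {x. p x \<in> N}" by (rule AE_completion)
      then show "AE x in lebesgue. (x \<in> W' r) = (x \<in> W r)"
        by eventually_elim (use Wsub[of r] in blast)
    qed
    also have "\<dots> = (\<integral>y. indicat_real (W' r) y *\<^sub>R h (y \<bullet> e) \<partial>lborel)"
      unfolding set_lebesgue_integral_def by (rule integral_completion) simp
    also have "\<dots> = (\<integral>y. indicat_real S (p y) *\<^sub>R (indicat_real {-r..r} (y \<bullet> e) *\<^sub>R h (y \<bullet> e)) \<partial>lborel)"
      by (intro Bochner_Integration.integral_cong) (auto simp: W'_def indicator_def)
    also have "\<dots> = (\<integral>y. (indicat_real {-r..r} (y \<bullet> e) *\<^sub>R h (y \<bullet> e)) \<partial>density lborel (\<lambda>x. ennreal (indicat_real S (p x))))"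
      by (rule integral_density[symmetric]) auto
    also have "\<dots> = (\<integral>y. (indicat_real {-r..r} (y \<bullet> e) *\<^sub>R h (y \<bullet> e)) \<partial>density lborel (\<lambda>x. indicator S (p x)))"
      by (simp add: ennreal_indicator)
    also have "\<dots> = (\<integral>s. (indicat_real {-r..r} s *\<^sub>R h s) \<partial>distr (density lborel (\<lambda>x. indicator S (p x))) borel (\<lambda>x. x \<bullet> e))"
      by (rule integral_distr[symmetric]) auto
    also have "\<dots> = (\<integral>s. v *\<^sub>R (indicat_real {-r..r} s *\<^sub>R h s) \<partial>lborel)"
      unfolding dist using v by (intro integral_density) auto
    also have "\<dots> = complex_of_real v * (LINT s:{-r..r}|lborel. h s)"
      unfolding set_lebesgue_integral_def by (simp add: scaleR_conv_of_real)
    finally show ?thesis .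
  qed
  with v Wm show ?thesis using that unfolding W_def by blast
qed

text \<open>\<open>lebesgue\<close> on a product type completes the product of the
  \<open>lborel\<close> measures and is not itself a product measure. Fubini is therefore applied to
  the Borel main parts \<open>T'\<close> and \<open>W'\<close>, and the difference is caught in the
  null set \<open>N\<close> of two strips.\<close>

lemma set_integral_Times_lebesgue:
  fixes f :: "'a::euclidean_space \<Rightarrow> complex" and g :: "'b::euclidean_space \<Rightarrow> complex"
  assumes T: "T \<in> lmeasurable" and W: "W \<in> lmeasurable"
    and f[measurable]: "f \<in> borel_measurable borel" and fb: "\<And>x. norm (f x) \<le> 1"
    and g[measurable]: "g \<in> borel_measurable borel" and gb: "\<And>x. norm (g x) \<le> 1"
  shows "T \<times> W \<in> sets lebesgue"
    "(LINT z:T \<times> W|lebesgue. f (fst z) * g (snd z)) = (LINT x:T|lebesgue. f x) * (LINT y:W|lebesgue. g y)"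
proof -
  have Ts: "T \<in> sets lebesgue" and Ws: "W \<in> sets lebesgue" using T W by auto
  define T' where "T' = main_part lborel T"
  define W' where "W' = main_part lborel W"
  have T'[measurable]: "T' \<in> sets borel" and W'[measurable]: "W' \<in> sets borel"
    using main_part_sets[OF Ts] main_part_sets[OF Ws] by (auto simp: T'_def W'_def)
  obtain NT where NT: "NT \<in> null_sets lborel" "null_part lborel T \<subseteq> NT"
    using null_part[OF Ts] by blast
  obtain NW where NW: "NW \<in> null_sets lborel" "null_part lborel W \<subseteq> NW"
    using null_part[OF Ws] by blast
  have TU: "T = T' \<union> null_part lborel T" and WU: "W = W' \<union> null_part lborel W"
    using main_part_null_part_Un[OF Ts] main_part_null_part_Un[OF Ws] by (simp_all add: T'_def W'_def)
  have [measurable]: "NT \<in> sets borel" "NW \<in> sets borel" using NT NW by auto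
  define N where "N = NT \<times> (UNIV :: 'b set) \<union> (UNIV :: 'a set) \<times> NW"
  have N: "N \<in> null_sets lborel"
  proof -
    have "NT \<times> (UNIV :: 'b set) \<in> null_sets (lborel \<Otimes>\<^sub>M lborel)"
      using NT by (intro null_setsI) (auto simp: lborel.emeasure_pair_measure_Times null_setsD1)
    moreover have "(UNIV :: 'a set) \<times> NW \<in> null_sets (lborel \<Otimes>\<^sub>M lborel)"
      using NW by (intro null_setsI) (auto simp: lborel.emeasure_pair_measure_Times null_setsD1)
    ultimately show ?thesis unfolding N_def lborel_prod by (rule null_sets.Un)
  qed
  have diff: "T \<times> W - T' \<times> W' \<subseteq> N" and sub: "T' \<times> W' \<subseteq> T \<times> W"
    using TU WU NT(2) NW(2) unfolding N_def by blast+
  have bor: "T' \<times> W' \<in> sets borel"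
    by (intro borel_Times T' W')
  have "T \<times> W - T' \<times> W' \<in> sets lebesgue" using N diff by (rule null_sets_completion)
  then have "T' \<times> W' \<union> (T \<times> W - T' \<times> W') \<in> sets lebesgue" using bor by (intro sets.Un) auto
  then show TW: "T \<times> W \<in> sets lebesgue" using sub by (simp add: Un_absorb1)
  have emT: "emeasure lborel T' < \<infinity>" and emW: "emeasure lborel W' < \<infinity>"
    using T W by (auto simp: T'_def W'_def fmeasurable_def)
  \<comment> \<open>Passage from a Lebesgue set to a Borel core, stated over a fresh type so that it
    serves the product and both factors.\<close>
  have cong: "(LINT x:A|lebesgue. k x) = (LINT x:A'|lborel. k x)"
    if "A \<in> sets lebesgue" "A' \<in> sets borel" "A - A' \<subseteq> Z" "A' \<subseteq> A" "Z \<in> null_sets lborel"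
      "k \<in> borel_measurable borel"
    for A A' Z :: "'z::euclidean_space set" and k :: "'z \<Rightarrow> complex"
  proof -
    have km: "k \<in> borel_measurable lebesgue" using that(6) by (intro measurable_completion) simp
    have "(LINT x:A|lebesgue. k x) = (LINT x:A'|lebesgue. k x)"
    proof (rule set_integral_cong_set)
      show "set_borel_measurable lebesgue A k"
        unfolding set_borel_measurable_def using that(1) km by measurable
      show "set_borel_measurable lebesgue A' k"
        unfolding set_borel_measurable_def using km that(2)
        by (intro borel_measurable_scaleR borel_measurable_indicator) auto
      have "AE x in lborel. x \<notin> Z" using that(5) by (rule AE_not_in)
      then have "AE x in lebesgue. x \<notin> Z" by (rule AE_completion)
      then show "AE x in lebesgue. (x \<in> A') = (x \<in> A)"
        by eventually_elim (use that(3,4) in blast)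
    qed
    also have "\<dots> = (LINT x:A'|lborel. k x)"
      unfolding set_lebesgue_integral_def
      by (intro integral_completion borel_measurable_scaleR borel_measurable_indicator) (use that in auto)
    finally show ?thesis .
  qed
  have fT: "integrable lborel (\<lambda>x. indicat_real T' x *\<^sub>R f x)"
    by (rule Bochner_Integration.integrable_bound[of _ "indicat_real T'"])
      (use emT fb in \<open>auto simp: indicator_def integrable_indicator_iff\<close>)
  have gW: "integrable lborel (\<lambda>x. indicat_real W' x *\<^sub>R g x)"
    by (rule Bochner_Integration.integrable_bound[of _ "indicat_real W'"])
      (use emW gb in \<open>auto simp: indicator_def integrable_indicator_iff\<close>)
  have "(LINT z:T \<times> W|lebesgue. f (fst z) * g (snd z)) = (LINT z:T' \<times> W'|lborel. f (fst z) * g (snd z))"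
    by (rule cong[OF TW bor diff sub N]) (simp add: borel_prod[symmetric])
  also have "\<dots> = (\<integral>z. (indicat_real T' (fst z) *\<^sub>R f (fst z)) * (indicat_real W' (snd z) *\<^sub>R g (snd z)) \<partial>(lborel \<Otimes>\<^sub>M lborel))"
    unfolding set_lebesgue_integral_def lborel_prod
    by (intro Bochner_Integration.integral_cong) (auto simp: indicator_def)
  also have "\<dots> = (\<integral>x. (\<integral>y. (indicat_real T' x *\<^sub>R f x) * (indicat_real W' y *\<^sub>R g y) \<partial>lborel) \<partial>lborel)"
  proof -
    have "integrable (lborel \<Otimes>\<^sub>M lborel) (\<lambda>z. (indicat_real T' (fst z) *\<^sub>R f (fst z)) * (indicat_real W' (snd z) *\<^sub>R g (snd z)))"
    proof (rule lborel_pair.Fubini_integrable)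
      show "integrable lborel (\<lambda>x. \<integral>y. norm ((indicat_real T' (fst (x, y)) *\<^sub>R f (fst (x, y))) * (indicat_real W' (snd (x, y)) *\<^sub>R g (snd (x, y)))) \<partial>lborel)"
        unfolding fst_conv snd_conv norm_mult integral_mult_right_zero
        by (intro integrable_mult_left integrable_norm fT)
      show "AE x in lborel. integrable lborel (\<lambda>y. (indicat_real T' (fst (x, y)) *\<^sub>R f (fst (x, y))) * (indicat_real W' (snd (x, y)) *\<^sub>R g (snd (x, y))))"
        unfolding fst_conv snd_conv by (intro AE_I2 integrable_mult_right gW)
    qed auto
    from lborel_pair.integral_fst'[OF this] show ?thesis by simp
  qed
  also have "\<dots> = (LINT x:T'|lborel. f x) * (LINT y:W'|lborel. g y)"
    unfolding set_lebesgue_integral_def by (simp only: integral_mult_right_zero integral_mult_left_zero)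
  also have "(LINT x:T'|lborel. f x) = (LINT x:T|lebesgue. f x)"
    by (rule cong[OF Ts T' _ _ NT(1) f, symmetric]) (use TU NT(2) in auto)
  also have "(LINT x:W'|lborel. g x) = (LINT x:W|lebesgue. g x)"
    by (rule cong[OF Ws W' _ _ NW(1) g, symmetric]) (use WU NW(2) in auto)
  finally show "(LINT z:T \<times> W|lebesgue. f (fst z) * g (snd z)) = (LINT x:T|lebesgue. f x) * (LINT y:W|lebesgue. g y)" .
qed

lemma set_integral_scaleR_lebesgue:
  fixes f :: "'a::euclidean_space \<Rightarrow> complex"
  assumes t: "t > 0" and S: "S \<in> lmeasurable" and f: "f \<in> borel_measurable borel"
  shows "(*\<^sub>R) t ` S \<in> lmeasurable"
    "(LINT x:(*\<^sub>R) t ` S|lebesgue. f x) = of_real (t ^ DIM('a)) * (LINT x:S|lebesgue. f (t *\<^sub>R x))"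
proof -
  show tS: "(*\<^sub>R) t ` S \<in> lmeasurable"
  proof (rule fmeasurableI)
    have tm: "(\<lambda>x::'a. (1 / t) *\<^sub>R x) \<in> lebesgue \<rightarrow>\<^sub>M lebesgue"
      by (rule lebesgue_measurable_scaling)
    have "(*\<^sub>R) t ` S = (\<lambda>x. (1 / t) *\<^sub>R x) -` S"
      using t by (force simp: image_iff)
    then show "(*\<^sub>R) t ` S \<in> sets lebesgue"
      using measurable_sets[OF tm, of S] S by auto
    have "emeasure lebesgue ((*\<^sub>R) t ` S) = ennreal (\<bar>t\<bar> ^ DIM('a)) * emeasure lebesgue S"
      using emeasure_lebesgue_affine[of t 0 S] by simp
    also have "\<dots> < \<infinity>"
      using S by (simp add: fmeasurable_def ennreal_mult_less_top del: emeasure_completion)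
    finally show "emeasure lebesgue ((*\<^sub>R) t ` S) < \<infinity>" .
  qed
  have eq: "(\<lambda>x. 0 + (\<Sum>j\<in>Basis. (t * (x \<bullet> j)) *\<^sub>R j)) = (\<lambda>x::'a. t *\<^sub>R x)"
    by (simp add: scaleR_scaleR[symmetric] scaleR_sum_right[symmetric] euclidean_representation
        del: scaleR_scaleR)
  have leb: "lebesgue = density (distr lebesgue lebesgue (\<lambda>x::'a. t *\<^sub>R x)) (\<lambda>_. ennreal (t ^ DIM('a)))"
    using lebesgue_affine_euclidean[of "\<lambda>_. t" "0 :: 'a"] t unfolding eq by simp
  have tm: "(\<lambda>x::'a. t *\<^sub>R x) \<in> lebesgue \<rightarrow>\<^sub>M lebesgue"
    using lebesgue_affine_measurable[of "\<lambda>_. t" "0 :: 'a"] t unfolding eq by simp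
  define h where "h x = indicat_real ((*\<^sub>R) t ` S) x *\<^sub>R f x" for x
  have hm: "h \<in> borel_measurable lebesgue"
  proof -
    have "f \<in> borel_measurable lebesgue" using f by (intro measurable_completion) simp
    then show ?thesis
      unfolding h_def using tS by (intro borel_measurable_scaleR borel_measurable_indicator) auto
  qed
  have "(\<integral>x. h x \<partial>lebesgue) = (\<integral>x. t ^ DIM('a) *\<^sub>R h x \<partial>distr lebesgue lebesgue (\<lambda>x. t *\<^sub>R x))"
    by (subst leb, rule integral_density) (use hm t in auto)
  also have "\<dots> = (\<integral>x. t ^ DIM('a) *\<^sub>R h (t *\<^sub>R x) \<partial>lebesgue)"
    by (rule integral_distr[OF tm]) (use hm in measurable)
  also have "\<dots> = of_real (t ^ DIM('a)) * (LINT x:S|lebesgue. f (t *\<^sub>R x))"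
  proof -
    have "h (t *\<^sub>R x) = indicat_real S x *\<^sub>R f (t *\<^sub>R x)" for x
      using t by (auto simp: h_def indicator_def)
    then show ?thesis by (simp add: set_lebesgue_integral_def scaleR_conv_of_real)
  qed
  finally show "(LINT x:(*\<^sub>R) t ` S|lebesgue. f x) = of_real (t ^ DIM('a)) * (LINT x:S|lebesgue. f (t *\<^sub>R x))"
    unfolding h_def set_lebesgue_integral_def .
qed

section \<open>Fourier transforms of bounded sets and of intervals\<close>

text \<open>The Fourier transform of a bounded set along a line is an entire function; if it vanished
  on a ray, its Taylor coefficients at the point 2 would vanish, and with them its value at 0,
  which is the volume of the set.\<close>

lemma fourier_bounded_set_nonzero:
  fixes S :: "'a::euclidean_space set" and e :: 'a
  assumes bS: "bounded S" and S: "S \<in> lmeasurable" and pos: "measure lebesgue S > 0"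
  shows "\<exists>c\<ge>1. (LINT x:S|lebesgue. cis (2 * pi * c * (x \<bullet> e))) \<noteq> 0"
proof (rule ccontr)
  assume neg: "\<not> ?thesis"
  define M where "M = lebesgue_on S"
  have Sm: "S \<in> sets lebesgue" using S by blast
  interpret finite_measure M unfolding M_def by (rule finite_measure_lebesgue_on[OF S])
  have toM: "(LINT x:S|lebesgue. f x) = (\<integral>x. f x \<partial>M)" for f :: "'a \<Rightarrow> complex"
    unfolding M_def using Sm by (subst integral_restrict_space) (auto simp: set_lebesgue_integral_def)
  have spM: "space M = S" unfolding M_def by simp
  define u where "u x = 2 * pi * (x \<bullet> e)" for x
  have "(\<lambda>x. u x) \<in> borel_measurable borel" unfolding u_def by simp
  then have um[measurable]: "u \<in> borel_measurable M"
    unfolding M_def by (intro measurable_restrict_space1 measurable_completion) simp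
  obtain R where R: "\<And>x. x \<in> S \<Longrightarrow> norm x \<le> R" using bS unfolding bounded_iff by blast
  define K where "K = 2 * pi * (\<bar>R\<bar> * norm e)"
  have uK: "\<bar>u x\<bar> \<le> K" if "x \<in> S" for x
  proof -
    have "\<bar>x \<bullet> e\<bar> \<le> norm x * norm e" by (rule Cauchy_Schwarz_ineq2)
    also have "\<dots> \<le> \<bar>R\<bar> * norm e" using R[OF that] by (intro mult_right_mono) auto
    finally show ?thesis by (simp add: u_def K_def abs_mult)
  qed
  have K0: "K \<ge> 0" by (simp add: K_def)
  \<comment> \<open>Taylor terms around frequency 2. Boundedness of \<open>S\<close> bounds
    \<open>u\<close>, which makes the series converge on the whole plane.\<close>
  define t where "t n x = (\<i> * of_real (u x)) ^ n / fact n * cis (2 * u x)" for n x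
  have tm[measurable]: "t n \<in> borel_measurable M" for n
  proof -
    have "(\<lambda>x. cis (2 * u x)) \<in> borel_measurable M" unfolding cis_conv_exp by measurable
    then show ?thesis unfolding t_def by measurable
  qed
  have tb: "norm (t n x) \<le> K ^ n / fact n" if "x \<in> S" for n x
    using uK[OF that] unfolding t_def
    by (simp add: norm_mult norm_divide norm_power divide_right_mono power_mono)
  have tint: "integrable M (t n)" for n
    by (rule integrable_const_bound[of _ "K ^ n / fact n"]) (use tb spM in auto)
  define b where "b n = (\<integral>x. t n x \<partial>M)" for n
  \<comment> \<open>\<open>G z\<close> is the transform at frequency \<open>2 + z\<close>: the
    assumed vanishing covers all real \<open>z \<ge> -1\<close>, while \<open>z = -2\<close> is
    frequency 0.\<close>
  define G where "G z = (\<integral>x. exp (\<i> * of_real (u x) * z) * cis (2 * u x) \<partial>M)" for z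
  have exp_sums: "(\<lambda>n. t n x * z ^ n) sums (exp (\<i> * of_real (u x) * z) * cis (2 * u x))" for x z
  proof -
    have "(\<lambda>n. (\<i> * of_real (u x) * z) ^ n /\<^sub>R fact n * cis (2 * u x)) sums (exp (\<i> * of_real (u x) * z) * cis (2 * u x))"
      by (intro sums_mult2 exp_converges)
    then show ?thesis
      unfolding t_def by (simp add: power_mult_distrib scaleR_conv_of_real field_simps)
  qed
  have ser: "(\<lambda>n. b n * z ^ n) sums G z" for z
  proof -
    have bound: "norm (t n x * z ^ n) \<le> (K * norm z) ^ n / fact n" if "x \<in> S" for n x
      using mult_right_mono[OF tb[OF that, of n], of "norm z ^ n"]
      by (simp add: norm_mult norm_power power_mult_distrib)
    have expK: "summable (\<lambda>n. (K * norm z) ^ n / fact n)"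
      using summable_exp_generic[of "K * norm z"] by (simp add: field_simps)
    have i: "integrable M (\<lambda>x. t n x * z ^ n)" for n
      by (intro integrable_mult_left tint)
    have s1: "AE x in M. summable (\<lambda>n. norm (t n x * z ^ n))"
    proof (rule AE_I2)
      fix x assume "x \<in> space M"
      then show "summable (\<lambda>n. norm (t n x * z ^ n))"
        using bound spM by (intro summable_comparison_test'[OF expK, of 0]) auto
    qed
    have s2: "summable (\<lambda>n. \<integral>x. norm (t n x * z ^ n) \<partial>M)"
    proof (rule summable_comparison_test')
      show "summable (\<lambda>n. (K * norm z) ^ n / fact n * measure M (space M))"
        by (intro summable_mult2 expK)
      fix n :: nat
      have "(\<integral>x. norm (t n x * z ^ n) \<partial>M) \<le> (\<integral>x. (K * norm z) ^ n / fact n \<partial>M)"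
        by (rule integral_mono) (use i bound spM in \<open>auto intro!: integrable_norm\<close>)
      then show "norm (\<integral>x. norm (t n x * z ^ n) \<partial>M) \<le> (K * norm z) ^ n / fact n * measure M (space M)"
        by (simp add: mult.commute)
    qed
    have "(\<lambda>n. \<integral>x. t n x * z ^ n \<partial>M) sums (\<integral>x. (\<Sum>n. t n x * z ^ n) \<partial>M)"
      using summable_sums[OF summable_integral[OF i s1 s2]] integral_suminf[OF i s1 s2] by simp
    then show ?thesis
      unfolding b_def G_def using exp_sums by (simp add: sums_iff)
  qed
  have G_real: "G (of_real s) = (LINT x:S|lebesgue. cis (2 * pi * (2 + s) * (x \<bullet> e)))" for s
    unfolding toM G_def
    by (intro Bochner_Integration.integral_cong)
      (auto simp: u_def cis_conv_exp exp_add[symmetric] algebra_simps)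
  have G0: "G (of_real s) = 0" if "s \<ge> -1" for s
    using neg that unfolding G_real by auto
  have bz: "b m = 0" for m
  \<comment> \<open>The isolation of zeros used below concerns coefficients of positive index, so
    index 0 is read off from \<open>G 0 = 0\<close>.\<close>
  proof (cases "m = 0")
    case True
    have "G 0 = b 0" using sums_unique2[OF ser[of 0]] powser_sums_zero[of b] by blast
    then show ?thesis using G0[of 0] True by simp
  next
    case False
    show ?thesis
    proof (rule ccontr)
      assume "b m \<noteq> 0"
      \<comment> \<open>A nonzero coefficient would make 0 an isolated zero of \<open>G\<close>, yet
        \<open>G\<close> vanishes at every positive real.\<close>
      then obtain s where "0 < s" and s: "\<And>z. z \<in> cball 0 s - {0} \<Longrightarrow> G z \<noteq> 0"
        using powser_0_nonzero[of 1 0 b G m] ser False G0[of 0] by auto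
      then show False using s[of "of_real s"] G0[of s] by simp
    qed
  qed
  have "G (of_real (- 2)) = 0"
    using sums_unique2[OF ser[of "of_real (- 2)"]] by (simp add: bz)
  moreover have "G (of_real (- 2)) = of_real (measure lebesgue S)"
    unfolding G_real set_lebesgue_integral_def using Sm by (simp add: scaleR_conv_of_real)
  ultimately show False using pos by simp
qed

section \<open>Oscillatory integrals over intervals and sines with integer frequencies\<close>

lemma set_integral_cis_Icc:
  fixes w r :: real
  assumes "w \<noteq> 0" "r \<ge> 0"
  shows "(LINT s:{-r..r}|lborel. cis (w * s)) = of_real (2 * sin (w * r) / w)"
proof -
  define F where "F s = exp (\<i> * of_real w * of_real s) / (\<i> * of_real w)" for s :: real
  have "(LINT s:{-r..r}|lborel. cis (w * s)) = F r - F (- r)"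
    unfolding set_lebesgue_integral_def
  proof (rule integral_FTC_Icc)
    fix x :: real
    have "((\<lambda>z. exp (\<i> * of_real w * z) / (\<i> * of_real w)) has_field_derivative exp (\<i> * of_real w * of_real x)) (at (of_real x))"
      using assms by (auto intro!: derivative_eq_intros)
    from has_vector_derivative_real_field[OF this]
    show "(F has_vector_derivative cis (w * x)) (at x within {-r..r})"
      unfolding F_def by (simp add: cis_conv_exp mult.assoc)
  next
    show "continuous_on {-r..r} (\<lambda>s. cis (w * s))" by (intro continuous_intros)
  qed (use assms in auto)
  also have "\<dots> = (cis (w * r) - cis (- (w * r))) / (\<i> * of_real w)"
    by (simp add: F_def cis_conv_exp diff_divide_distrib mult.assoc)
  also have "\<dots> = of_real (2 * sin (w * r) / w)"
    using assms by (simp add: complex_eq_iff Re_divide Im_divide power2_eq_square)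
  finally show ?thesis .
qed

text \<open>Integer endpoints make the primitive vanish at both ends. This yields exact
  orthogonality of the cosines below, with no error terms to control.\<close>

lemma integral_cos_symmetric_Icc:
  fixes N :: nat and j :: int
  assumes "j \<noteq> 0"
  shows "(\<integral>s. indicator {- real N..real N} s * cos (2 * pi * of_int j * s) \<partial>lborel) = 0"
proof -
  define w where "w = 2 * pi * of_int j"
  have w: "w \<noteq> 0" using assms by (simp add: w_def)
  have "(\<integral>s. indicator {- real N..real N} s *\<^sub>R cos (w * s) \<partial>lborel) = sin (w * real N) / w - sin (w * - real N) / w"
  proof (rule integral_FTC_Icc)
    fix x :: real
    have "((\<lambda>s. sin (w * s) / w) has_real_derivative cos (w * x)) (at x within {- real N..real N})"
      using w by (auto intro!: derivative_eq_intros)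
    then show "((\<lambda>s. sin (w * s) / w) has_vector_derivative cos (w * x)) (at x within {- real N..real N})"
      by (simp add: has_real_derivative_iff_has_vector_derivative)
  qed (auto intro!: continuous_intros)
  moreover have "sin (w * real N) = 0"
  proof -
    have "w * real N = 2 * pi * of_int (j * int N)" by (simp add: w_def)
    then show ?thesis by (simp only: sin_integer_2pi Ints_of_int)
  qed
  ultimately show ?thesis by (simp add: w_def)
qed

text \<open>On a set of positive measure where all the \<open>sin (2 \<pi> k\<^sub>n r)\<close> tend to 0, the orthogonal
  functions \<open>cos (4 \<pi> k\<^sub>n r)\<close> would tend to 1, contradicting Bessel's inequality.\<close>

lemma null_set_sin_tendsto_0:
  fixes k :: "nat \<Rightarrow> int"
  assumes k0: "\<And>n. k n \<noteq> 0" and inj: "inj (\<lambda>n. \<bar>k n\<bar>)"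
  shows "{r. (\<lambda>n. sin (2 * pi * of_int (k n) * r)) \<longlonglongrightarrow> 0} \<in> null_sets lborel"
proof -
  define E where "E = {r::real. (\<lambda>n. sin (2 * pi * of_int (k n) * r)) \<longlonglongrightarrow> 0}"
  have Em[measurable]: "E \<in> sets borel"
  proof -
    have "E = {r \<in> space borel. (\<lambda>n. sin (2 * pi * of_int (k n) * r)) \<longlonglongrightarrow> 0}" by (simp add: E_def)
    also have "\<dots> \<in> sets borel" by measurable
    finally show ?thesis .
  qed
  have "E \<inter> {- real N..real N} \<in> null_sets lborel" for N
  proof (rule ccontr)
    assume nn: "E \<inter> {- real N..real N} \<notin> null_sets lborel"
    define I where "I = {- real N..real N}"
    define A where "A = E \<inter> I"
    have [measurable]: "I \<in> sets borel" "A \<in> sets borel" by (auto simp: I_def A_def)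
    have Afin: "emeasure lborel A < \<infinity>"
    proof -
      have "emeasure lborel A \<le> emeasure lborel I" by (rule emeasure_mono) (auto simp: A_def)
      also have "\<dots> < \<infinity>" by (simp add: I_def)
      finally show ?thesis .
    qed
    define \<delta> where "\<delta> = measure lborel A"
    have \<delta>: "\<delta> > 0"
    proof -
      have "emeasure lborel A \<noteq> 0" using nn by (auto simp: A_def I_def null_sets_def)
      then show ?thesis
        using Afin unfolding \<delta>_def measure_def by (simp add: enn2real_positive_iff less_top zero_less_iff_neq_zero)
    qed
    have Npos: "real N > 0"
    proof (rule ccontr)
      assume "\<not> real N > 0"
      then have "A \<subseteq> {0}" by (auto simp: A_def I_def)
      then have "emeasure lborel A \<le> emeasure lborel {0::real}" by (rule emeasure_mono) simp
      then show False using \<delta> by (simp add: \<delta>_def measure_def)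
    qed
    define c where "c n r = indicat_real I r * cos (2 * pi * of_int (2 * k n) * r)" for n r
    have cm[measurable]: "c n \<in> borel_measurable borel" for n unfolding c_def by measurable
    have Iint: "integrable lborel (indicat_real I)" by (auto simp: I_def)
    have Aint: "integrable lborel (indicat_real A)" using Afin by auto
    have cb: "\<bar>c n r\<bar> \<le> indicat_real I r" for n r by (auto simp: c_def indicator_def)
    have cAint: "integrable lborel (\<lambda>r. indicat_real A r * c n r)" for n
    proof (rule Bochner_Integration.integrable_bound[OF Iint])
      show "AE r in lborel. norm (indicat_real A r * c n r) \<le> norm (indicat_real I r)"
      proof (rule AE_I2)
        fix r show "norm (indicat_real A r * c n r) \<le> norm (indicat_real I r)"
          using cb[of n r] by (cases "r \<in> I") (auto simp: indicator_def)
      qed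
    qed simp
    have ccint: "integrable lborel (\<lambda>r. c n r * c m r)" for n m
    proof (rule Bochner_Integration.integrable_bound[OF Iint])
      show "AE r in lborel. norm (c n r * c m r) \<le> norm (indicat_real I r)"
      proof (rule AE_I2)
        fix r show "norm (c n r * c m r) \<le> norm (indicat_real I r)"
          using mult_mono[OF cb[of n r] cb[of m r]]
          by (cases "r \<in> I") (auto simp: abs_mult indicator_def)
      qed
    qed simp
    \<comment> \<open>The squared norm is half the length \<open>2 * N\<close> of the interval, by
      the product formula for cosines.\<close>
    have cc: "(\<integral>r. c n r * c m r \<partial>lborel) = (if n = m then real N else 0)" for n m
    proof -
      have ci: "integrable lborel (\<lambda>r. indicat_real I r * cos (2 * pi * of_int j * r))" for j
        by (rule Bochner_Integration.integrable_bound[OF Iint]) (auto simp: indicator_def)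
      have "(\<integral>r. c n r * c m r \<partial>lborel) = (\<integral>r. (indicat_real I r * cos (2 * pi * of_int (2 * k n - 2 * k m) * r)
          + indicat_real I r * cos (2 * pi * of_int (2 * k n + 2 * k m) * r)) / 2 \<partial>lborel)"
      proof (intro Bochner_Integration.integral_cong refl)
        fix r
        define x y where "x = 2 * pi * of_int (2 * k n) * r" and "y = 2 * pi * of_int (2 * k m) * r"
        have "2 * pi * of_int (2 * k n - 2 * k m) * r = x - y" "2 * pi * of_int (2 * k n + 2 * k m) * r = x + y"
          by (simp_all add: x_def y_def algebra_simps)
        then show "c n r * c m r = (indicat_real I r * cos (2 * pi * of_int (2 * k n - 2 * k m) * r)
          + indicat_real I r * cos (2 * pi * of_int (2 * k n + 2 * k m) * r)) / 2"
          using cos_times_cos[of x y]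
          by (cases "r \<in> I") (simp_all only: c_def x_def[symmetric] y_def[symmetric] indicator_simps, simp_all)
      qed
      also have "\<dots> = ((\<integral>r. indicat_real I r * cos (2 * pi * of_int (2 * k n - 2 * k m) * r) \<partial>lborel)
          + (\<integral>r. indicat_real I r * cos (2 * pi * of_int (2 * k n + 2 * k m) * r) \<partial>lborel)) / 2"
        using ci by (simp del: of_int_add of_int_diff of_int_mult)
      also have "\<dots> = (if n = m then real N else 0)"
      proof (cases "n = m")
        case True
        then show ?thesis
          using integral_cos_symmetric_Icc[of "2 * k n + 2 * k m" N] k0[of m] by (simp add: I_def)
      next
        case False
        \<comment> \<open>Distinct absolute values are needed because both the difference and the
          sum of the frequencies must be nonzero.\<close>
        then have "\<bar>k n\<bar> \<noteq> \<bar>k m\<bar>" using inj by (auto simp: inj_on_def)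
        then have "2 * k n + 2 * k m \<noteq> 0" "2 * k n - 2 * k m \<noteq> 0" by auto
        then show ?thesis
          unfolding I_def using False integral_cos_symmetric_Icc by (simp del: of_int_add of_int_diff of_int_mult)
      qed
      finally show ?thesis .
    qed
    have "(\<lambda>n. \<integral>r. indicat_real A r * c n r \<partial>lborel) \<longlonglongrightarrow> (\<integral>r. indicat_real A r \<partial>lborel)"
    proof (rule integral_dominated_convergence)
      show "AE r in lborel. (\<lambda>n. indicat_real A r * c n r) \<longlonglongrightarrow> indicat_real A r"
      proof (rule AE_I2)
        fix r
        show "(\<lambda>n. indicat_real A r * c n r) \<longlonglongrightarrow> indicat_real A r"
        proof (cases "r \<in> A")
          case True
          then have "(\<lambda>n. 1 - 2 * (sin (2 * pi * of_int (k n) * r))\<^sup>2) \<longlonglongrightarrow> 1 - 2 * 0\<^sup>2"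
            by (intro tendsto_intros) (auto simp: A_def E_def)
          moreover have "c n r = 1 - 2 * (sin (2 * pi * of_int (k n) * r))\<^sup>2" for n
            using True cos_double_sin[of "2 * pi * of_int (k n) * r"]
            by (simp add: c_def A_def mult.assoc mult.left_commute)
          ultimately show ?thesis using True by simp
        qed simp
      qed
      show "AE r in lborel. norm (indicat_real A r * c n r) \<le> indicat_real I r" for n
      proof (rule AE_I2)
        fix r show "norm (indicat_real A r * c n r) \<le> indicat_real I r"
          using cb[of n r] by (cases "r \<in> I") (auto simp: indicator_def)
      qed
    qed (use Iint in auto)
    then have "(\<lambda>n. \<integral>r. indicat_real A r * c n r \<partial>lborel) \<longlonglongrightarrow> \<delta>" by (simp add: \<delta>_def)
    then have "\<forall>\<^sub>F n in sequentially. \<delta> / 2 < (\<integral>r. indicat_real A r * c n r \<partial>lborel)"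
      using \<delta> by (intro order_tendstoD) auto
    then obtain n0 where n0: "\<And>n. n \<ge> n0 \<Longrightarrow> \<delta> / 2 < (\<integral>r. indicat_real A r * c n r \<partial>lborel)"
      unfolding eventually_sequentially by blast
    \<comment> \<open>Bessel's inequality in elementary form: expand the squared distance between a
      sum of \<open>m\<close> orthogonal cosines and \<open>l\<close> times the indicator of
      \<open>A\<close>, where each cosine has inner product more than \<open>\<delta> / 2\<close>
      with that indicator.\<close>
    have ineq: "0 \<le> real N * real m - l * (real m * \<delta>) + l\<^sup>2 * \<delta>" if l: "l \<ge> 0" for l m
    proof -
      define J where "J = {n0..<n0 + m}"
      have "0 \<le> (\<integral>r. ((\<Sum>n\<in>J. c n r) - l * indicat_real A r)\<^sup>2 \<partial>lborel)" by simp
      also have "\<dots> = (\<integral>r. (\<Sum>n\<in>J. \<Sum>i\<in>J. c n r * c i r) - 2 * l * (\<Sum>n\<in>J. indicat_real A r * c n r) + l\<^sup>2 * indicat_real A r \<partial>lborel)"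
      proof (intro Bochner_Integration.integral_cong refl)
        fix r
        have "(indicat_real A r)\<^sup>2 = indicat_real A r" by (simp add: indicator_def)
        then show "((\<Sum>n\<in>J. c n r) - l * indicat_real A r)\<^sup>2 = (\<Sum>n\<in>J. \<Sum>i\<in>J. c n r * c i r) - 2 * l * (\<Sum>n\<in>J. indicat_real A r * c n r) + l\<^sup>2 * indicat_real A r"
          by (simp add: power2_diff power2_eq_square sum_product sum_distrib_left[symmetric] algebra_simps)
      qed
      also have "\<dots> = (\<Sum>n\<in>J. \<Sum>i\<in>J. (if n = i then real N else 0)) - 2 * l * (\<Sum>n\<in>J. \<integral>r. indicat_real A r * c n r \<partial>lborel) + l\<^sup>2 * \<delta>"
        using ccint cAint Aint by (simp add: cc \<delta>_def)
      also have "(\<Sum>n\<in>J. \<Sum>i\<in>J. (if n = i then real N else 0)) = real N * real m"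
        by (simp add: J_def)
      also have "real N * real m - 2 * l * (\<Sum>n\<in>J. \<integral>r. indicat_real A r * c n r \<partial>lborel) + l\<^sup>2 * \<delta>
          \<le> real N * real m - 2 * l * (\<Sum>n\<in>J. \<delta> / 2) + l\<^sup>2 * \<delta>"
        using l n0 by (intro add_right_mono diff_left_mono mult_left_mono sum_mono) (auto simp: J_def less_imp_le)
      finally show ?thesis by (simp add: J_def)
    qed
    obtain m :: nat where m: "4 * real N / \<delta> < real m" using reals_Archimedean2 by blast
    \<comment> \<open>With \<open>l = 2 * N / \<delta>\<close> the mixed term is twice the first
      one, so the expression decreases linearly in \<open>m\<close>.\<close>
    have "0 \<le> real N * real m - (2 * real N / \<delta>) * (real m * \<delta>) + (2 * real N / \<delta>)\<^sup>2 * \<delta>"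
      using \<delta> by (intro ineq) simp
    also have "\<dots> = real N * (4 * real N / \<delta> - real m)"
      using \<delta> by (simp add: power2_eq_square field_simps)
    also have "\<dots> < 0" using m Npos by (simp add: mult_pos_neg)
    finally show False by simp
  qed
  then have "(\<Union>N. E \<inter> {- real N..real N}) \<in> null_sets lborel" by (rule null_sets_UN)
  moreover have "(\<Union>N. E \<inter> {- real N..real N}) = E"
  proof (intro equalityI subsetI)
    fix x assume "x \<in> E"
    moreover obtain N where "\<bar>x\<bar> \<le> real N" using real_arch_simple by blast
    ultimately show "x \<in> (\<Union>N. E \<inter> {- real N..real N})" by (auto simp: abs_le_iff intro!: exI[of _ N])
  qed auto
  ultimately show ?thesis by (simp add: E_def)
qed

section \<open>Diophantine approximation and the number variance\<close>

text \<open>Take \<open>p\<close> as the integer nearest to \<open>q * a\<close>. Then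
  \<open>q - p\<close> differs by at most 1/2 from \<open>q * (1 - a)\<close>, which is unbounded
  because the Liouville property excludes \<open>a = 1\<close>. This permits thinning to strictly
  increasing \<open>\<bar>q - p\<bar>\<close>, the form required for orthogonality, and
  \<open>\<bar>1 - a\<bar> < 1\<close> gives the upper bound.\<close>

lemma liouville_approximations:
  assumes psi: "incr_slowly \<psi>" and liou: "psi_liouville \<psi> a" and a: "0 < a" "a < 2"
  obtains q p :: "nat \<Rightarrow> int"
  where "\<And>n. q n > 0" "\<And>n. of_int (q n) * a - of_int (p n) \<noteq> 0"
    "filterlim (\<lambda>n. inverse \<bar>of_int (q n) * a - of_int (p n)\<bar>) at_top sequentially"
    "\<And>n. of_int (q n) \<le> \<psi> (inverse \<bar>of_int (q n) * a - of_int (p n)\<bar>)"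
    "\<And>n. q n \<noteq> p n" "inj (\<lambda>n. \<bar>q n - p n\<bar>)" "\<And>n. \<bar>q n - p n\<bar> \<le> 2 * q n"
proof -
  have mono: "\<And>x y. 0 < x \<Longrightarrow> x \<le> y \<Longrightarrow> \<psi> x \<le> \<psi> y"
    using psi unfolding incr_slowly_def by (auto intro: mono_onD)
  obtain Q where Q: "filterlim Q at_top sequentially"
    and Qpsi: "\<And>n. \<psi> (inverse (dist_int (of_int (Q n) * a))) \<ge> of_int (Q n)"
    using liou unfolding psi_liouville_def by blast
  define P where "P n = round (of_int (Q n) * a)" for n
  define d where "d n = dist_int (of_int (Q n) * a)" for n
  have d_eq: "d n = \<bar>of_int (Q n) * a - of_int (P n)\<bar>" for n
    by (simp add: d_def dist_int_def P_def)
  have d_half: "d n \<le> 1 / 2" for n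
    unfolding d_eq P_def using of_int_round_abs_le[of "of_int (Q n) * a"] by (simp add: abs_minus_commute)
  have Qreal: "filterlim (\<lambda>n. real_of_int (Q n)) at_top sequentially"
    using filterlim_compose[OF filterlim_real_of_int_at_top Q] .
  have Qgt: "\<forall>\<^sub>F n in sequentially. M < real_of_int (Q n)" for M
    using Qreal unfolding filterlim_at_top_dense by blast
  \<comment> \<open>If \<open>d n = 0\<close>, then \<open>inverse 0 = 0\<close> turns the
    hypothesis into \<open>Q n \<le> \<psi> 0\<close>, which fails for large
    \<open>n\<close>.\<close>
  have d_pos: "\<forall>\<^sub>F n in sequentially. d n \<noteq> 0"
    using Qgt[of "\<psi> 0"]
  proof eventually_elim
    case (elim n)
    then show ?case using Qpsi[of n] by (auto simp: d_def)
  qed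
  have d_inv: "filterlim (\<lambda>n. inverse (d n)) at_top sequentially"
    unfolding filterlim_at_top_dense
  proof
    fix M :: real
    show "\<forall>\<^sub>F n in sequentially. M < inverse (d n)"
      \<comment> \<open>The maximum with 1 keeps the argument positive, where \<open>\<psi>\<close>
        is known to be monotone.\<close>
      using Qgt[of "\<psi> (max M 1)"] d_pos
    proof eventually_elim
      case (elim n)
      show ?case
      proof (rule ccontr)
        assume "\<not> M < inverse (d n)"
        moreover have "0 < inverse (d n)" using elim(2) by (simp add: d_eq)
        ultimately have "\<psi> (inverse (d n)) \<le> \<psi> (max M 1)" by (intro mono) auto
        then show False using Qpsi[of n] elim(1) by (simp add: d_def)
      qed
    qed
  qed
  have "a \<noteq> 1"
  proof
    assume "a = 1"
    then have "d n = 0" for n by (simp add: d_def dist_int_def)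
    then show False using d_pos by simp
  qed
  have k_ge: "\<bar>real_of_int (Q n - P n)\<bar> \<ge> real_of_int (Q n) * \<bar>1 - a\<bar> - 1 / 2" for n
  proof -
    have "real_of_int (Q n) * \<bar>1 - a\<bar> \<le> \<bar>real_of_int (Q n) * (1 - a)\<bar>"
      by (simp add: abs_mult mult_right_mono)
    also have "\<dots> \<le> \<bar>real_of_int (Q n - P n)\<bar> + d n"
      unfolding d_eq by (simp add: algebra_simps)
    finally show ?thesis using d_half[of n] by simp
  qed
  have k_gt: "\<forall>\<^sub>F n in sequentially. M < \<bar>real_of_int (Q n - P n)\<bar>" for M
    using Qgt[of "(M + 1 / 2) / \<bar>1 - a\<bar>"]
  proof eventually_elim
    case (elim n)
    then have "M + 1 / 2 < real_of_int (Q n) * \<bar>1 - a\<bar>"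
      using \<open>a \<noteq> 1\<close> by (simp add: pos_divide_less_eq)
    then show ?case using k_ge[of n] by linarith
  qed
  define good where "good n \<longleftrightarrow> Q n > 0 \<and> d n \<noteq> 0 \<and> Q n \<noteq> P n" for n
  have good: "\<forall>\<^sub>F n in sequentially. good n"
    using Qgt[of 0] d_pos k_gt[of 0] by eventually_elim (auto simp: good_def)
  \<comment> \<open>One choice makes the indices and the values \<open>\<bar>Q - P\<bar>\<close>
    strictly increasing: the indices preserve the limits, the values give injectivity.\<close>
  have "\<exists>s. \<forall>n. good (s n) \<and> (s n < s (Suc n) \<and> \<bar>Q (s n) - P (s n)\<bar> < \<bar>Q (s (Suc n)) - P (s (Suc n))\<bar>)"
  proof (rule dependent_nat_choice)
    show "\<exists>n. good n" using eventually_happens'[OF _ good] by simp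
    fix x n :: nat
    have "\<forall>\<^sub>F y in sequentially. good y \<and> x < y \<and> \<bar>Q x - P x\<bar> < \<bar>Q y - P y\<bar>"
      using good eventually_gt_at_top[of x] k_gt[of "\<bar>real_of_int (Q x - P x)\<bar>"]
    proof eventually_elim
      case (elim y)
      then have "real_of_int \<bar>Q x - P x\<bar> < real_of_int \<bar>Q y - P y\<bar>" by simp
      then show ?case using elim by (simp only: of_int_less_iff)
    qed
    then show "\<exists>y. good y \<and> x < y \<and> \<bar>Q x - P x\<bar> < \<bar>Q y - P y\<bar>"
      by (rule eventually_happens'[OF sequentially_bot])
  qed
  then obtain s where s: "\<And>n. good (s n)" "\<And>n. s n < s (Suc n)"
    "\<And>n. \<bar>Q (s n) - P (s n)\<bar> < \<bar>Q (s (Suc n)) - P (s (Suc n))\<bar>" by blast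
  have sm: "strict_mono s" using s(2) by (simp add: strict_mono_Suc_iff)
  have "strict_mono (\<lambda>n. \<bar>Q (s n) - P (s n)\<bar>)" using s(3) by (simp add: strict_mono_Suc_iff)
  then have inj: "inj (\<lambda>n. \<bar>Q (s n) - P (s n)\<bar>)" by (rule strict_mono_imp_inj_on)
  have k_le: "\<bar>Q (s n) - P (s n)\<bar> \<le> 2 * Q (s n)" for n
  proof -
    have Q1: "Q (s n) \<ge> 1" using s(1)[of n] by (simp add: good_def)
    have "\<bar>real_of_int (Q (s n) - P (s n))\<bar> \<le> \<bar>real_of_int (Q (s n)) * (1 - a)\<bar> + d (s n)"
      unfolding d_eq by (simp add: algebra_simps)
    also have "\<bar>real_of_int (Q (s n)) * (1 - a)\<bar> \<le> real_of_int (Q (s n))"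
      using Q1 a by (simp add: abs_mult mult_left_le)
    \<comment> \<open>The rounding error is at most 1/2, and \<open>Q + 1/2 \<le> 2 * Q\<close>
      because \<open>Q \<ge> 1\<close>.\<close>
    finally have "real_of_int \<bar>Q (s n) - P (s n)\<bar> \<le> real_of_int (2 * Q (s n))"
      using d_half[of "s n"] Q1 by simp
    then show ?thesis by (simp only: of_int_le_iff)
  qed
  show ?thesis
  proof (rule that[of "Q \<circ> s" "P \<circ> s"])
    show "filterlim (\<lambda>n. inverse \<bar>of_int ((Q \<circ> s) n) * a - of_int ((P \<circ> s) n)\<bar>) at_top sequentially"
      using filterlim_compose[OF d_inv filterlim_subseq[OF sm]] by (simp add: d_eq)
    show "of_int ((Q \<circ> s) n) \<le> \<psi> (inverse \<bar>of_int ((Q \<circ> s) n) * a - of_int ((P \<circ> s) n)\<bar>)" for n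
      using Qpsi[of "s n"] by (simp add: d_def[symmetric] d_eq[symmetric])
    show "(Q \<circ> s) n > 0" "of_int ((Q \<circ> s) n) * a - of_int ((P \<circ> s) n) \<noteq> 0" "(Q \<circ> s) n \<noteq> (P \<circ> s) n" for n
      using s(1)[of n] by (auto simp: good_def d_eq)
  qed (use inj k_le in auto)
qed

section \<open>The lower bound at a dual vector and the conclusion\<close>

lemma norm_set_integral_cis_minus:
  "norm (LINT x:S|M. cis (- g x)) = norm (LINT x:S|M. cis (g x))"
proof -
  have "(LINT x:S|M. cis (- g x)) = (\<integral>x. cnj (indicat_real S x *\<^sub>R cis (g x)) \<partial>M)"
    unfolding set_lebesgue_integral_def
    by (intro Bochner_Integration.integral_cong) (auto simp: cis_cnj)
  also have "\<dots> = cnj (LINT x:S|M. cis (g x))"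
    unfolding set_lebesgue_integral_def by (rule Bochner_Integration.integral_cnj)
  finally show ?thesis by simp
qed

text \<open>The character of a dual vector with one component along \<open>e\<close> and one along
  \<open>e'\<close> splits over the product window. Dilating back from \<open>t\<close> times
  \<open>S\<close> to \<open>S\<close> produces the factor \<open>t ^ DIM('a)\<close> and multiplies
  the frequency by \<open>t\<close>.\<close>

lemma NV_ge_dual_vector:
  fixes \<Gamma> :: "('a::euclidean_space \<times> 'b::euclidean_space) set"
    and e :: 'a and e' :: 'b
  assumes L: "lattice \<Gamma>" and inj: "inj_on fst \<Gamma>" and e': "norm e' = 1"
    and \<xi>: "(\<epsilon> *\<^sub>R e, \<kappa> *\<^sub>R e') \<in> dual_lattice \<Gamma>" and \<kappa>: "\<kappa> \<noteq> 0"
    and t: "t > 0" and S: "S \<in> lmeasurable" and S_bdd: "bounded S"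
    and W: "W \<in> lmeasurable" and W_bdd: "bounded W"
  shows "(t ^ DIM('a) * norm (LINT x:S|lebesgue. cis (2 * pi * (t * \<bar>\<epsilon>\<bar>) * (x \<bullet> e)))
        * norm (LINT y:W|lebesgue. cis (2 * pi * \<kappa> * (y \<bullet> e'))))\<^sup>2
      \<le> measure lebesgue (fund_dom \<Gamma>) * NV t \<Gamma> S W"
proof -
  define T where "T = (*\<^sub>R) t ` S"
  define f where "f x = cis (2 * pi * \<epsilon> * (x \<bullet> e))" for x
  define g where "g y = cis (2 * pi * \<kappa> * (y \<bullet> e'))" for y
  define \<theta> where "\<theta> z = f (fst z) * g (snd z)" for z
  \<comment> \<open>Two forms of one character: the product form factors the integral, the inner
    product form gives periodicity under \<open>\<Gamma>\<close>.\<close>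
  have \<theta>_inner: "\<theta> z = cis (2 * pi * ((\<epsilon> *\<^sub>R e, \<kappa> *\<^sub>R e') \<bullet> z))" for z
    by (cases z) (simp add: \<theta>_def f_def g_def cis_mult inner_commute algebra_simps)
  have fm: "f \<in> borel_measurable borel"
    unfolding f_def cis_conv_exp by measurable
  have gm: "g \<in> borel_measurable borel"
    unfolding g_def cis_conv_exp by measurable
  have Tl: "T \<in> lmeasurable"
    unfolding T_def by (rule set_integral_scaleR_lebesgue(1)[OF t S fm])
  have T_bdd: "bounded T" unfolding T_def by (rule bounded_scaling[OF S_bdd])
  have bdd: "bounded (T \<times> W)" by (rule bounded_Times[OF T_bdd W_bdd])
  have "T \<times> W \<in> sets lebesgue"
    by (rule set_integral_Times_lebesgue(1)[OF Tl W fm _ gm]) (simp_all add: f_def g_def)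
  then have X: "T \<times> W \<in> lmeasurable" using bdd by (rule bounded_set_imp_lmeasurable[rotated])
  have "(norm (LINT z:T \<times> W|lebesgue. \<theta> z))\<^sup>2
      \<le> measure lebesgue (fund_dom \<Gamma>) * NV t \<Gamma> S W"
    unfolding NV_def T_def[symmetric]
  proof (rule number_variance_ge_character[OF L inj fund_dom_fundamental_domain[OF L] X bdd,
        where v = "(0, (1 / (2 * \<kappa>)) *\<^sub>R e')" and z = "- 1"])
    show "\<theta> \<in> borel_measurable borel"
      unfolding \<theta>_inner[abs_def] cis_conv_exp by measurable
    show "norm (\<theta> s) \<le> 1" for s by (simp add: \<theta>_inner)
    show "\<theta> (s + \<gamma>) = \<theta> s" if "\<gamma> \<in> \<Gamma>" for s \<gamma>
    proof -
      have "(\<epsilon> *\<^sub>R e, \<kappa> *\<^sub>R e') \<bullet> \<gamma> \<in> \<int>" using \<xi> that unfolding dual_lattice_def by blast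
      then show ?thesis
        unfolding \<theta>_inner inner_add_right ring_distribs cis_mult[symmetric] by (simp del: inner_Pair)
    qed
    \<comment> \<open>A shift by half a period along \<open>e'\<close>, where the frequency
      \<open>\<kappa>\<close> is nonzero, multiplies \<open>\<theta>\<close> by -1.\<close>
    have "(\<epsilon> *\<^sub>R e, \<kappa> *\<^sub>R e') \<bullet> (0, (1 / (2 * \<kappa>)) *\<^sub>R e') = 1 / 2"
      using e' \<kappa> by (simp add: dot_square_norm)
    then show "\<theta> (s + (0, (1 / (2 * \<kappa>)) *\<^sub>R e')) = \<theta> s * - 1" for s
      unfolding \<theta>_inner inner_add_right ring_distribs cis_mult[symmetric]
      by (simp only:) simp
  qed simp
  moreover have "norm (LINT z:T \<times> W|lebesgue. \<theta> z)
    = t ^ DIM('a) * norm (LINT x:S|lebesgue. cis (2 * pi * (t * \<bar>\<epsilon>\<bar>) * (x \<bullet> e)))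
        * norm (LINT y:W|lebesgue. cis (2 * pi * \<kappa> * (y \<bullet> e')))"
  proof -
    have "(LINT z:T \<times> W|lebesgue. \<theta> z) = (LINT x:T|lebesgue. f x) * (LINT y:W|lebesgue. g y)"
      unfolding \<theta>_def
      by (rule set_integral_Times_lebesgue(2)[OF Tl W fm _ gm]) (simp_all add: f_def g_def)
    moreover have "norm (LINT x:T|lebesgue. f x) = t ^ DIM('a) * norm (LINT x:S|lebesgue. f (t *\<^sub>R x))"
      unfolding T_def set_integral_scaleR_lebesgue(2)[OF t S fm] using t by (simp add: norm_mult norm_power)
    moreover have "norm (LINT x:S|lebesgue. f (t *\<^sub>R x))
        = norm (LINT x:S|lebesgue. cis (2 * pi * (t * \<bar>\<epsilon>\<bar>) * (x \<bullet> e)))"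
    \<comment> \<open>Complex conjugation absorbs the sign of \<open>\<epsilon>\<close>, so only
      \<open>t * \<bar>\<epsilon>\<bar>\<close> enters the norm.\<close>
    proof (cases "\<epsilon> \<ge> 0")
      case True
      then show ?thesis by (simp add: f_def mult_ac)
    next
      case False
      then show ?thesis
        using norm_set_integral_cis_minus[where S = S and M = lebesgue and g = "\<lambda>x. 2 * pi * (t * \<bar>\<epsilon>\<bar>) * (x \<bullet> e)"]
        by (simp add: f_def mult_ac)
    qed
    ultimately show ?thesis by (simp add: norm_mult g_def)
  qed
  ultimately show ?thesis by simp
qed

theorem theoremA6:
  fixes \<psi> :: "real \<Rightarrow> real" and a :: real
    and e_down :: "'a::euclidean_space" and e_left :: "'b::euclidean_space"
    and \<Gamma>t :: "('a \<times> 'b) set" and \<Gamma> :: "('a \<times> 'b) set"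
    and \<Omega>_down :: "'a set" and \<Upsilon> :: "'b set"
  assumes psi: "incr_slowly \<psi>"
    and a_pos: "0 < a" and a_lt: "a < 2"
    and liou: "psi_liouville \<psi> a"
    and e_down_unit: "norm e_down = 1" and e_left_unit: "norm e_left = 1"
    and Gt: "lattice_in ({x. x \<bullet> e_down = 0} \<times> {y. y \<bullet> e_left = 0}) \<Gamma>t"
    and G: "lattice \<Gamma>"
    and G_dual: "dual_lattice \<Gamma> =
        {of_int m *\<^sub>R (a *\<^sub>R e_down, e_left) + of_int n *\<^sub>R (e_down, e_left) + g
          | m n g. g \<in> \<Gamma>t}"
    and SA: "standing_assumption \<Gamma>"
    and Od_bdd: "bounded \<Omega>_down" and Od_per: "finite_perimeter_in UNIV \<Omega>_down"
    and Od_vol: "measure lebesgue \<Omega>_down > 0"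
    and U_sub: "\<Upsilon> \<subseteq> {y. y \<bullet> e_left = 0}"
    and U_bdd: "bounded \<Upsilon>" and U_per: "finite_perimeter_in {y. y \<bullet> e_left = 0} \<Upsilon>"
    and U_vol: "measure (sub_lebesgue {y. y \<bullet> e_left = 0}) \<Upsilon> > 0"
  shows "\<exists>t :: nat \<Rightarrow> real. filterlim t at_top sequentially \<and>
           (\<exists>A. A \<subseteq> {0<..} \<and> {0<..} - A \<in> null_sets lebesgue \<and>
              (\<forall>r\<in>A. \<forall>f :: real \<Rightarrow> real. (\<forall>x>0. f x > 0) \<and> filterlim f at_top at_top \<longrightarrow>
                 limsup (\<lambda>n. ereal (NV (t n) \<Gamma> \<Omega>_down
                        {s *\<^sub>R e_left + u | s u. s \<in> {-r..r} \<and> u \<in> \<Upsilon>}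
                      / ((t n) ^ (2 * DIM('a)) * inverse ((\<psi> (t n))\<^sup>2) * inverse (f (t n)))))
                 = \<infinity>))"
proof -
  obtain q p :: "nat \<Rightarrow> int" where q_pos: "\<And>n. q n > 0"
    and eps0: "\<And>n. of_int (q n) * a - of_int (p n) \<noteq> 0"
    and eps_inv: "filterlim (\<lambda>n. inverse \<bar>of_int (q n) * a - of_int (p n)\<bar>) at_top sequentially"
    and q_psi: "\<And>n. of_int (q n) \<le> \<psi> (inverse \<bar>of_int (q n) * a - of_int (p n)\<bar>)"
    and qp: "\<And>n. q n \<noteq> p n" and inj: "inj (\<lambda>n. \<bar>q n - p n\<bar>)"
    and k_le: "\<And>n. \<bar>q n - p n\<bar> \<le> 2 * q n"
    by (rule liouville_approximations[OF psi liou a_pos a_lt]) (rule that)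
  define \<epsilon> where "\<epsilon> n = of_int (q n) * a - of_int (p n)" for n
  define k where "k n = q n - p n" for n
  have k0: "k n \<noteq> 0" for n using qp by (simp add: k_def)
  have "\<Omega>_down \<in> sets lebesgue"
    using Od_vol measure_notin_sets by fastforce
  then have Odl: "\<Omega>_down \<in> lmeasurable"
    using Od_bdd by (rule bounded_set_imp_lmeasurable[rotated])
  obtain c where c1: "c \<ge> 1" and Fc: "(LINT x:\<Omega>_down|lebesgue. cis (2 * pi * c * (x \<bullet> e_down))) \<noteq> 0"
    using fourier_bounded_set_nonzero[OF Od_bdd Odl Od_vol] by blast
  define F where "F = norm (LINT x:\<Omega>_down|lebesgue. cis (2 * pi * c * (x \<bullet> e_down)))"
  have F: "F > 0" using Fc by (simp add: F_def)
  define W where "W r = {s *\<^sub>R e_left + u | s u. s \<in> {-r..r} \<and> u \<in> \<Upsilon>}" for r :: real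
  obtain v where v: "v > 0" and Wm: "\<And>r. W r \<in> sets lebesgue"
    and Wint: "\<And>r h. h \<in> borel_measurable borel \<Longrightarrow>
      (LINT y:W r|lebesgue. h (y \<bullet> e_left)) = complex_of_real v * (LINT s:{-r..r}|lborel. h s)"
    by (rule cylinder_slices[OF e_left_unit U_sub U_vol]) (rule that[unfolded W_def])
  have W_bdd: "bounded (W r)" for r
  proof -
    obtain K where K: "\<And>u. u \<in> \<Upsilon> \<Longrightarrow> norm u \<le> K" using U_bdd unfolding bounded_iff by blast
    have "norm y \<le> \<bar>r\<bar> + K" if y: "y \<in> W r" for y
    proof -
      obtain s u where su: "y = s *\<^sub>R e_left + u" "s \<in> {-r..r}" "u \<in> \<Upsilon>"
        using y unfolding W_def by blast
      have "norm (s *\<^sub>R e_left) \<le> \<bar>r\<bar>" using su(2) e_left_unit by auto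
      then show ?thesis
        using norm_triangle_ineq[of "s *\<^sub>R e_left" u] K[OF su(3)] unfolding su(1) by linarith
    qed
    then show ?thesis unfolding bounded_iff by blast
  qed
  have Wl: "W r \<in> lmeasurable" for r
    using W_bdd Wm by (rule bounded_set_imp_lmeasurable)
  have Wnorm: "norm (LINT y:W r|lebesgue. cis (2 * pi * of_int j * (y \<bullet> e_left)))
      = v * \<bar>sin (2 * pi * of_int j * r)\<bar> / (pi * \<bar>of_int j\<bar>)" if "r > 0" "j \<noteq> 0" for r and j :: int
  proof -
    have "(LINT y:W r|lebesgue. cis (2 * pi * of_int j * (y \<bullet> e_left)))
        = complex_of_real v * (LINT s:{-r..r}|lborel. cis (2 * pi * of_int j * s))"
      by (rule Wint) (simp add: cis_conv_exp)
    also have "\<dots> = complex_of_real v * of_real (2 * sin (2 * pi * of_int j * r) / (2 * pi * of_int j))"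
      using that by (subst set_integral_cis_Icc) auto
    finally show ?thesis
      using v that by (simp only: norm_mult norm_of_real) (simp add: abs_mult abs_divide)
  qed
  have zero_Gt: "0 \<in> \<Gamma>t"
  proof -
    obtain B where "\<Gamma>t = {(\<Sum>b\<in>B. of_int (c b) *\<^sub>R b) | c. True}"
      using Gt unfolding lattice_in_def by blast
    moreover have "(0 :: 'a \<times> 'b) = (\<Sum>b\<in>B. of_int 0 *\<^sub>R b)" by simp
    ultimately show ?thesis by (auto intro!: exI[of _ "\<lambda>_. 0"])
  qed
  have dual: "(\<epsilon> n *\<^sub>R e_down, of_int (k n) *\<^sub>R e_left) \<in> dual_lattice \<Gamma>" for n
  proof -
    have "(\<epsilon> n *\<^sub>R e_down, of_int (k n) *\<^sub>R e_left)
        = of_int (q n) *\<^sub>R (a *\<^sub>R e_down, e_left) + of_int (- p n) *\<^sub>R (e_down, e_left) + 0"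
      by (simp add: \<epsilon>_def k_def scaleR_left_diff_distrib)
    then show ?thesis unfolding G_dual using zero_Gt by blast
  qed
  define t where "t n = c * inverse \<bar>\<epsilon> n\<bar>" for n
  have t_eps: "t n * \<bar>\<epsilon> n\<bar> = c" for n using eps0[of n] by (simp add: t_def \<epsilon>_def)
  have t_pos: "t n > 0" for n using eps0[of n] c1 by (simp add: t_def \<epsilon>_def)
  have t_lim: "filterlim t at_top sequentially"
    unfolding t_def \<epsilon>_def
    by (rule filterlim_tendsto_pos_mult_at_top[OF tendsto_const _ eps_inv]) (use c1 in simp)
  have q_le: "of_int (q n) \<le> \<psi> (t n)" for n
  proof -
    have pos: "0 < inverse \<bar>\<epsilon> n\<bar>" using eps0[of n] by (simp add: \<epsilon>_def)
    then have "inverse \<bar>\<epsilon> n\<bar> \<le> t n" using c1 by (simp add: t_def)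
    moreover have "mono_on {0<..} \<psi>" using psi by (simp add: incr_slowly_def)
    ultimately have "\<psi> (inverse \<bar>\<epsilon> n\<bar>) \<le> \<psi> (t n)"
      using pos t_pos[of n] by (intro mono_onD[of "{0<..}" \<psi>]) auto
    then show ?thesis using q_psi[of n] unfolding \<epsilon>_def by linarith
  qed
  define V where "V = measure lebesgue (fund_dom \<Gamma>)"
  have V0: "V \<ge> 0" by (simp add: V_def)
  \<comment> \<open>The factor 4 comes from squaring
    \<open>\<bar>k n\<bar> \<le> 2 * \<psi> (t n)\<close>, and \<open>pi\<^sup>2\<close> from the
    transform of the interval. \<open>V + 1\<close> replaces the covolume \<open>V\<close> so that
    the divisor is visibly positive.\<close>
  define C where "C = F\<^sup>2 * v\<^sup>2 / (4 * pi\<^sup>2 * (V + 1))"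
  have C: "C > 0" using F v V0 by (simp add: C_def)
  \<comment> \<open>This holds for every \<open>n\<close> and every \<open>r > 0\<close>; the
    exceptional radii enter only through the size of the sine.\<close>
  have lower: "C * (sin (2 * pi * of_int (k n) * r))\<^sup>2 * f (t n)
      \<le> NV (t n) \<Gamma> \<Omega>_down (W r) / ((t n) ^ (2 * DIM('a)) * inverse ((\<psi> (t n))\<^sup>2) * inverse (f (t n)))"
    if r: "r > 0" and f: "\<And>x. x > 0 \<Longrightarrow> f x > 0" for r n and f :: "real \<Rightarrow> real"
  proof -
    define S where "S = \<bar>sin (2 * pi * of_int (k n) * r)\<bar>"
    define X where "X = NV (t n) \<Gamma> \<Omega>_down (W r)"
    define d where "d = t n ^ DIM('a)"
    define j where "j = \<bar>real_of_int (k n)\<bar>"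
    have d: "d > 0" using t_pos by (simp add: d_def)
    have j: "j > 0" using k0[of n] by (simp add: j_def)
    have fp: "f (t n) > 0" using f t_pos by blast
    have X0: "X \<ge> 0" unfolding X_def NV_def set_lebesgue_integral_def by simp
    have "(d * F * (v * S / (pi * j)))\<^sup>2 \<le> V * X"
      using NV_ge_dual_vector[OF G _ e_left_unit dual _ t_pos Odl Od_bdd Wl W_bdd, of n n r] SA k0[of n]
      unfolding t_eps Wnorm[OF r k0] by (simp add: standing_assumption_def F_def S_def V_def X_def d_def j_def)
    also have "\<dots> \<le> (V + 1) * X" using X0 by (simp add: algebra_simps)
    finally have 1: "(d * F * (v * S / (pi * j)))\<^sup>2 \<le> (V + 1) * X" .
    have psi_pos: "\<psi> (t n) > 0" using psi t_pos unfolding incr_slowly_def by blast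
    have "j \<le> 2 * \<psi> (t n)"
    proof -
      have "j \<le> 2 * of_int (q n)"
        using k_le[of n] unfolding j_def k_def by linarith
      then show ?thesis using q_le[of n] by simp
    qed
    then have "j\<^sup>2 \<le> (2 * \<psi> (t n))\<^sup>2" using j by (intro power_mono) auto
    then have j2: "j\<^sup>2 \<le> 4 * (\<psi> (t n))\<^sup>2" by (simp add: power_mult_distrib)
    have "d\<^sup>2 * F\<^sup>2 * v\<^sup>2 * S\<^sup>2 = (d * F * (v * S / (pi * j)))\<^sup>2 * (pi\<^sup>2 * j\<^sup>2)"
      using j by (simp add: power_mult_distrib power_divide field_simps)
    also have "\<dots> \<le> ((V + 1) * X) * (pi\<^sup>2 * (4 * (\<psi> (t n))\<^sup>2))"
      using 1 j2 X0 V0 by (intro mult_mono) auto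
    finally have 2: "(F\<^sup>2 * v\<^sup>2) * (S\<^sup>2 * d\<^sup>2) \<le> (4 * pi\<^sup>2 * (V + 1)) * (X * (\<psi> (t n))\<^sup>2)"
      by (simp only: mult_ac)
    have Z: "4 * pi\<^sup>2 * (V + 1) > 0" using V0 by simp
    then have "F\<^sup>2 * v\<^sup>2 = C * (4 * pi\<^sup>2 * (V + 1))"
      unfolding C_def by (metis less_irrefl nonzero_eq_divide_eq)
    with 2 have "(4 * pi\<^sup>2 * (V + 1)) * (C * S\<^sup>2 * d\<^sup>2) \<le> (4 * pi\<^sup>2 * (V + 1)) * (X * (\<psi> (t n))\<^sup>2)"
      by (simp only: mult_ac)
    then have "C * S\<^sup>2 * d\<^sup>2 \<le> X * (\<psi> (t n))\<^sup>2"
      using Z by (simp only: mult_le_cancel_left_pos)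
    then have "C * S\<^sup>2 \<le> X * (\<psi> (t n))\<^sup>2 / d\<^sup>2" using d by (simp add: field_simps)
    then have "C * S\<^sup>2 * f (t n) \<le> X * (\<psi> (t n))\<^sup>2 / d\<^sup>2 * f (t n)"
      using fp by (intro mult_right_mono) auto
    also have "\<dots> = X / (d\<^sup>2 * inverse ((\<psi> (t n))\<^sup>2) * inverse (f (t n)))"
      by (simp add: field_simps)
    finally show ?thesis
      by (simp add: S_def X_def d_def power_mult[symmetric] mult.commute[of 2])
  qed
  define E where "E = {r. (\<lambda>n. sin (2 * pi * of_int (k n) * r)) \<longlonglongrightarrow> 0}"
  have E: "E \<in> null_sets lborel"
    unfolding E_def by (rule null_set_sin_tendsto_0) (use k0 inj in \<open>auto simp: k_def\<close>)
  have lim: "limsup (\<lambda>n. ereal (NV (t n) \<Gamma> \<Omega>_down (W r)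
      / ((t n) ^ (2 * DIM('a)) * inverse ((\<psi> (t n))\<^sup>2) * inverse (f (t n))))) = \<infinity>"
    (is "limsup ?X = \<infinity>")
    if r: "r > 0" "r \<notin> E" and f: "\<And>x. x > 0 \<Longrightarrow> f x > 0" and flim: "filterlim f at_top at_top"
    for r and f :: "real \<Rightarrow> real"
  proof (rule ccontr)
    assume "limsup ?X \<noteq> \<infinity>"
    then obtain m :: nat where "limsup ?X < ereal (real m)"
      unfolding less_PInf_Ex_of_nat by blast
    moreover define M where "M = real m"
    ultimately have "limsup ?X < ereal M" by simp
    then have ev: "\<forall>\<^sub>F n in sequentially. ?X n < ereal M" by (rule Limsup_lessD)
    \<comment> \<open>Failure of convergence to 0 gives a lower bound at infinitely many indices
      only, which matches the \<open>limsup\<close> in the claim.\<close>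
    obtain \<eta> where \<eta>: "\<eta> > 0"
      "\<exists>\<^sub>F n in sequentially. \<eta> \<le> \<bar>sin (2 * pi * of_int (k n) * r)\<bar>"
      using r(2) unfolding E_def tendsto_iff frequently_def by (auto simp: not_le)
    have "filterlim (\<lambda>n. f (t n)) at_top sequentially"
      by (rule filterlim_compose[OF flim t_lim])
    \<comment> \<open>Beyond this threshold, a sine of absolute value at least \<open>\<eta>\<close>
      would push the quotient up to \<open>M\<close>, against the assumed bound on the
      \<open>limsup\<close>.\<close>
    then have "\<forall>\<^sub>F n in sequentially. M / (C * \<eta>\<^sup>2) \<le> f (t n)"
      by (simp add: filterlim_at_top)
    with ev have "\<forall>\<^sub>F n in sequentially. \<bar>sin (2 * pi * of_int (k n) * r)\<bar> < \<eta>"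
    proof eventually_elim
      case (elim n)
      show ?case
      proof (rule ccontr)
        assume "\<not> \<bar>sin (2 * pi * of_int (k n) * r)\<bar> < \<eta>"
        then have "\<eta>\<^sup>2 \<le> (sin (2 * pi * of_int (k n) * r))\<^sup>2"
          using \<eta>(1) power_mono[of \<eta> "\<bar>sin (2 * pi * of_int (k n) * r)\<bar>" 2] by simp
        then have "C * \<eta>\<^sup>2 * f (t n) \<le> C * (sin (2 * pi * of_int (k n) * r))\<^sup>2 * f (t n)"
          using C f[OF t_pos[of n]] by (intro mult_right_mono mult_left_mono) auto
        also have "\<dots> < M" using lower[of r f n] r(1) f elim(1) by force
        finally show False
          using elim(2) C \<eta>(1) by (simp add: field_simps)
      qed
    qed
    then show False using \<eta>(2) by (simp add: frequently_def not_le)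
  qed
  have "{0<..} - ({0<..} - E) \<in> null_sets lebesgue"
  proof -
    have "{0<..} - ({0<..} - E) = {0<..} \<inter> E" by blast
    moreover have "{0<..} \<inter> E \<in> null_sets lborel" using E by (intro null_set_Int1) auto
    ultimately show ?thesis by (simp add: null_sets_completionI)
  qed
  then show ?thesis
    using t_lim lim unfolding W_def by (intro exI[of _ t] conjI exI[of _ "{0<..} - E"]) auto
qed

end
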